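(* Assume that the eigenvalues $\lambda_1,\dots,\lambda_m$ of $T(\cdot)$ in $\mathcal{D}$ are simple with linearly independent unit eigenvectors $u_1,\dots,u_m$. Let $$F_{\mathsf{nl}}^{[N]}(\rho):=\sum_{j=1}^{N}\frac{\omega_j}{\xi_j-\rho}\bigl(I-T(\xi_j)^{-1}T(\rho)\bigr),\qquad F_{\mathsf{ci}}(\rho):=\frac{1}{2\pi\mathrm{i}}\oint_{\partial\mathcal{D}}\frac{1}{\xi-\rho}\bigl(I-T(\xi)^{-1}T(\rho)\bigr)\,\mathrm{d}\xi ,$$ and assume that the quadrature nodes and weights $(\xi_j,\omega_j)$, $1\le j\le N$, satisfy $$\max\Bigl\{\Bigl\|\sum_{j=1}^{N}\frac{\omega_j}{\xi_j-\rho}H(\xi_j)-H(\rho)\Bigr\|,\ \bigl\|F_{\mathsf{ci}}(\rho)-F_{\mathsf{nl}}^{[N]}(\rho)\bigr\|\Bigr\}\le\gamma_N\qquad\text{for all }\rho\in\mathcal{D}_0,$$ where $\gamma_N=C_T\exp(-c_TN)$ with constants $c_T,C_T>0$ depending only on $T:\mathcal{D}\to\mathbb{C}^{n\times n}$, $H$ is the holomorphic part of $T(\cdot)^{-1}$ in Keldysh's decomposition, and $\mathcal{D}_0\subset\mathcal{D}$ is a compact set containing small neighborhoods of $\lambda_1,\dots,\lambda_m$. For $1\le i\le m$ let $(\rho_i,x_i)$ be arbitrary approximate eigenpairs with $$x_i=u_i+U_{-i}y_i+U_{\mathsf{out}}z_i,$$ let $\widehat{x}_i:=F_{\mathsf{nl}}^{[N]}(\rho_i)x_i$,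 and decompose $$\widehat{x}_i=\widehat{\alpha}_iu_i+U_{-i}\widehat{y}_i+U_{\mathsf{out}}\widehat{z}_i .$$ If $$\epsilon:=\max_{1\le i\le m}\max\bigl\{|\rho_i-\lambda_i|,\|y_i\|,\|z_i\|\bigr\}$$ is sufficiently small, then for all $i=1,\dots,m$, $$|\widehat{\alpha}_i-1|=\mathcal{O}(\gamma_N+\epsilon),\qquad\|\widehat{y}_i\|=\mathcal{O}(\gamma_N+\epsilon),\qquad\|\widehat{z}_i\|=\mathcal{O}(\gamma_N\epsilon).$$
   Context: Setting: $\mathcal{D}\subset\mathbb{C}$ is a nonempty domain enclosed by a Jordan curve $\partial\mathcal{D}$ (positively oriented, rectifiable, with $T(\xi)$ invertible on $\partial\mathcal{D}$ so that the contour integral is defined); $T(\cdot)$ is an $n\times n$ holomorphic matrix-valued function on some domain containing the closure of $\mathcal{D}$, with $\det T(\xi_0)\ne0$ for some $\xi_0\in\mathcal{D}$. An eigenpair $(\lambda,u)$ satisfies $T(\lambda)u=0$, $u\ne0$; $\lambda$ is simple if it is a simple zero of $\det T$. $\lambda_1,\dots,\lambda_m$ are all the eigenvalues in $\mathcal{D}$, and $T(\lambda_i)u_i=0$, $\|u_i\|=1$. Keldysh's decomposition: with $U_{\mathcal{D}}=[u_1,\dots,u_m]$, $J_{\mathcal{D}}=\operatorname{diag}(\lambda_1,\dots,\lambda_m)$, there are $W_{\mathcal{D}}=[w_1,\dots,w_m]\in\mathbb{C}^{n\times m}$ (left eigenvectors, with $w_i^{\mathsf{H}}T'(\lambda_i)u_i=1$)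 and a holomorphic matrix-valued $H(\cdot)$ such that $T(\xi)^{-1}=U_{\mathcal{D}}(\xi I-J_{\mathcal{D}})^{-1}W_{\mathcal{D}}^{\mathsf{H}}+H(\xi)$ for $\xi\in\mathcal{D}\setminus\{\lambda_1,\dots,\lambda_m\}$; the same formula defines $H$ at the quadrature nodes. Quadrature: $(\xi_j,\omega_j)$ (depending on $N$) are nodes and weights of a quadrature rule for the contour integral over $\partial\mathcal{D}$ (the factor $1/(2\pi\mathrm{i})$ is absorbed in $\omega_j$), with $T(\xi_j)$ invertible, so that $\sum_j\omega_j/(\xi_j-\xi)$ approximates the indicator function of $\mathcal{D}$. If $\rho=\xi_j$, the continuous extension of the corresponding term in $F_{\mathsf{nl}}^{[N]}$ is used. Decomposition: $U_{\mathsf{out}}$ is a fixed matrix whose columns form an orthonormal basis of the orthogonal complement of $\operatorname{range}(U_{\mathcal{D}})$; $U=[U_{\mathcal{D}},U_{\mathsf{out}}]$ is invertible; $U_{-i}=[u_1,\dots,u_{i-1},u_{i+1},\dots,u_m]$. The form of $x_i$ corresponds to the normalization $e_i^{\mathsf{H}}U^{-1}x_i=1$. $\|\cdot\|$ is the Euclidean/spectral norm. $\mathcal{O}(\cdot)$, and the threshold for "sufficiently small", involve only constants depending on $T(\cdot):\mathcal{D}\to\mathbb{C}^{n\times n}$ (not on $N$ or on the pairs $(\rho_i,x_i)$). *)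

theory Defs
  imports "HOL-Complex_Analysis.Complex_Analysis"
begin

text \<open>
  The library's \<^const>\<open>contour_integral\<close> integrates against \<^const>\<open>vector_derivative\<close>, which is
  adequate for piecewise continuously differentiable paths but not for an arbitrary rectifiable
  parametrization.  For a rectifiable curve the contour integral is the Riemann--Stieltjes integral,
  the limit of the sums of \<open>f (g t) * (g b - g a)\<close> over tagged partitions of the parameter interval
  into subintervals \<open>{a..b}\<close> with tag \<open>t\<close>, as the mesh tends to zero.
\<close>

definition rectifiable_path :: "(real \<Rightarrow> complex) \<Rightarrow> bool" where
  "rectifiable_path g \<longleftrightarrow> path g \<and>
     (\<exists>B. \<forall>p. p division_of {0..1} \<longrightarrow> (\<Sum>K\<in>p. norm (g (Sup K) - g (Inf K))) \<le> B)"

definition has_rs_contour_integral ::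
    "(complex \<Rightarrow> complex) \<Rightarrow> complex \<Rightarrow> (real \<Rightarrow> complex) \<Rightarrow> bool" where
  "has_rs_contour_integral f I g \<longleftrightarrow>
     (\<forall>e>0. \<exists>d>0. \<forall>p. p tagged_division_of {0..1} \<and> (\<lambda>t. ball t d) fine p \<longrightarrow>
        norm ((\<Sum>(t, K)\<in>p. f (g t) * (g (Sup K) - g (Inf K))) - I) < e)"

definition rs_contour_integral :: "(real \<Rightarrow> complex) \<Rightarrow> (complex \<Rightarrow> complex) \<Rightarrow> complex" where
  "rs_contour_integral g f = (THE I. has_rs_contour_integral f I g)"

definition mat_contour_integral ::
    "(real \<Rightarrow> complex) \<Rightarrow> (complex \<Rightarrow> complex^'n^'n) \<Rightarrow> complex^'n^'n" where
  "mat_contour_integral g F = (\<chi> a b. rs_contour_integral g (\<lambda>\<xi>. F \<xi> $ a $ b))"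

text \<open>On \<^typ>\<open>complex^'n\<close> the library inner product is the real one; this is the Hermitian product
  \<open>x\<^sup>H y\<close>.\<close>

definition hdot :: "complex^'n \<Rightarrow> complex^'n \<Rightarrow> complex" where
  "hdot x y = (\<Sum>a\<in>UNIV. cnj (x $ a) * y $ a)"

definition mat_scale :: "complex \<Rightarrow> complex^'n^'n \<Rightarrow> complex^'n^'n"  (infixr \<open>*m\<close> 75) where
  "c *m A = (\<chi> a b. c * A $ a $ b)"

text \<open>The library \<^const>\<open>norm\<close> of a matrix is the Frobenius norm.\<close>

definition spectral_norm :: "complex^'n^'n \<Rightarrow> real" where
  "spectral_norm A = onorm ((*v) A)"

definition coeff_norm :: "nat set \<Rightarrow> (nat \<Rightarrow> complex) \<Rightarrow> real" where
  "coeff_norm S y = L2_set (\<lambda>k. cmod (y k)) S"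

definition mat_holomorphic_on :: "(complex \<Rightarrow> complex^'n^'n) \<Rightarrow> complex set \<Rightarrow> bool" where
  "mat_holomorphic_on T S \<longleftrightarrow> (\<forall>a b. (\<lambda>z. T z $ a $ b) holomorphic_on S)"

definition mat_deriv :: "(complex \<Rightarrow> complex^'n^'n) \<Rightarrow> complex \<Rightarrow> complex^'n^'n" where
  "mat_deriv T z = (\<chi> a b. deriv (\<lambda>x. T x $ a $ b) z)"

definition eigenpair :: "(complex \<Rightarrow> complex^'n^'n) \<Rightarrow> complex \<Rightarrow> complex^'n \<Rightarrow> bool" where
  "eigenpair T z x \<longleftrightarrow> T z *v x = 0 \<and> x \<noteq> 0"

definition simple_eigenvalue :: "(complex \<Rightarrow> complex^'n^'n) \<Rightarrow> complex \<Rightarrow> bool" where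
  "simple_eigenvalue T z \<longleftrightarrow> (\<exists>x. eigenpair T z x) \<and> det (T z) = 0 \<and> zorder (\<lambda>x. det (T x)) z = 1"

text \<open>Matrices whose number of columns depends on \<open>m\<close> are represented by their columns, indexed by
  \<open>{1..m}\<close>.  The matrix \<open>U (\<xi> I - J)\<^sup>-\<^sup>1 W\<^sup>H\<close> has the entries below, with
  \<open>U = [u 1, \<dots>, u m]\<close>, \<open>J = diag (l 1, \<dots>, l m)\<close> and \<open>W = [w 1, \<dots>, w m]\<close>.\<close>

definition polar_part ::
    "nat \<Rightarrow> (nat \<Rightarrow> complex) \<Rightarrow> (nat \<Rightarrow> complex^'n) \<Rightarrow> (nat \<Rightarrow> complex^'n) \<Rightarrow> complex \<Rightarrow> complex^'n^'n"
  where
  "polar_part m l u w \<xi> = (\<chi> a b. \<Sum>k=1..m. u k $ a * (1 / (\<xi> - l k)) * cnj (w k $ b))"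

text \<open>\<open>H\<close> is required to be holomorphic only on \<open>D\<close>; at the remaining points of the domain \<open>\<Omega>\<close> of
  \<open>T\<close> where \<open>T\<close> is invertible, such as quadrature nodes on or outside the boundary of \<open>D\<close>, its value
  is given by the same formula.\<close>

definition keldysh ::
    "(complex \<Rightarrow> complex^'n^'n) \<Rightarrow> complex set \<Rightarrow> complex set \<Rightarrow> nat \<Rightarrow> (nat \<Rightarrow> complex) \<Rightarrow>
     (nat \<Rightarrow> complex^'n) \<Rightarrow> (nat \<Rightarrow> complex^'n) \<Rightarrow> (complex \<Rightarrow> complex^'n^'n) \<Rightarrow> bool" where
  "keldysh T \<Omega> D m l u w H \<longleftrightarrow>
     (\<forall>i\<in>{1..m}. (\<chi> a. cnj (w i $ a)) v* T (l i) = 0 \<and> hdot (w i) (mat_deriv T (l i) *v u i) = 1) \<and>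
     mat_holomorphic_on H D \<and>
     (\<forall>\<xi>\<in>\<Omega>. invertible (T \<xi>) \<longrightarrow> matrix_inv (T \<xi>) = polar_part m l u w \<xi> + H \<xi>)"

definition F_ci :: "(complex \<Rightarrow> complex^'n^'n) \<Rightarrow> (real \<Rightarrow> complex) \<Rightarrow> complex \<Rightarrow> complex^'n^'n" where
  "F_ci T g \<rho> = (1 / (2 * of_real pi * \<i>)) *m
     mat_contour_integral g (\<lambda>\<xi>. (1 / (\<xi> - \<rho>)) *m (mat 1 - matrix_inv (T \<xi>) ** T \<rho>))"

definition nl_quotient ::
    "(complex \<Rightarrow> complex^'n^'n) \<Rightarrow> complex \<Rightarrow> complex \<Rightarrow> complex \<Rightarrow> complex^'n^'n" where
  "nl_quotient T \<xi> \<omega> \<rho> = (\<omega> / (\<xi> - \<rho>)) *m (mat 1 - matrix_inv (T \<xi>) ** T \<rho>)"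

definition nl_term ::
    "(complex \<Rightarrow> complex^'n^'n) \<Rightarrow> complex \<Rightarrow> complex \<Rightarrow> complex \<Rightarrow> complex^'n^'n" where
  "nl_term T \<xi> \<omega> \<rho> =
     (if \<rho> = \<xi> then Lim (at \<xi>) (nl_quotient T \<xi> \<omega>) else nl_quotient T \<xi> \<omega> \<rho>)"

definition F_nl ::
    "(complex \<Rightarrow> complex^'n^'n) \<Rightarrow> nat \<Rightarrow> (nat \<Rightarrow> complex) \<Rightarrow> (nat \<Rightarrow> complex) \<Rightarrow> complex \<Rightarrow> complex^'n^'n"
  where
  "F_nl T N \<xi> \<omega> \<rho> = (\<Sum>j=1..N. nl_term T (\<xi> j) (\<omega> j) \<rho>)"

definition H_quad ::
    "(complex \<Rightarrow> complex^'n^'n) \<Rightarrow> nat \<Rightarrow> (nat \<Rightarrow> complex) \<Rightarrow> (nat \<Rightarrow> complex) \<Rightarrow> complex \<Rightarrow> complex^'n^'n"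
  where
  "H_quad H N \<xi> \<omega> \<rho> = (\<Sum>j=1..N. (\<omega> j / (\<xi> j - \<rho>)) *m H (\<xi> j))"

text \<open>The first sum has no value at a node \<open>\<rho> = \<xi> j\<close> (and division by zero would silently drop the
  term), so its bound is only required away from the nodes.\<close>

definition quadrature_accuracy ::
    "(complex \<Rightarrow> complex^'n^'n) \<Rightarrow> (real \<Rightarrow> complex) \<Rightarrow> (complex \<Rightarrow> complex^'n^'n) \<Rightarrow> complex set \<Rightarrow>
     nat \<Rightarrow> (nat \<Rightarrow> complex) \<Rightarrow> (nat \<Rightarrow> complex) \<Rightarrow> real \<Rightarrow> bool" where
  "quadrature_accuracy T g H D0 N \<xi> \<omega> \<gamma> \<longleftrightarrow>
     (\<forall>\<rho>\<in>D0. (\<rho> \<notin> \<xi> ` {1..N} \<longrightarrow> spectral_norm (H_quad H N \<xi> \<omega> \<rho> - H \<rho>) \<le> \<gamma>) \<and>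
              spectral_norm (F_ci T g \<rho> - F_nl T N \<xi> \<omega> \<rho>) \<le> \<gamma>)"

definition orthonormal_basis_of_complement ::
    "nat \<Rightarrow> (nat \<Rightarrow> complex^'n) \<Rightarrow> (nat \<Rightarrow> complex^'n) \<Rightarrow> bool" where
  "orthonormal_basis_of_complement m u v \<longleftrightarrow>
     (\<forall>k\<in>{m+1..CARD('n)}. \<forall>l\<in>{m+1..CARD('n)}. hdot (v k) (v l) = (if k = l then 1 else 0)) \<and>
     vec.span (v ` {m+1..CARD('n)}) = {x. \<forall>i\<in>{1..m}. hdot (u i) x = 0}"

text \<open>\<open>\<alpha> u i + U\<^sub>-\<^sub>i y + U\<^sub>o\<^sub>u\<^sub>t z\<close>, where \<open>y\<close> is indexed by \<open>{1..m} - {i}\<close> and \<open>z\<close> by the remaining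
  indices \<open>m+1, \<dots>, n\<close>.\<close>

definition combination ::
    "nat \<Rightarrow> (nat \<Rightarrow> complex^'n) \<Rightarrow> (nat \<Rightarrow> complex^'n) \<Rightarrow> nat \<Rightarrow>
     complex \<Rightarrow> (nat \<Rightarrow> complex) \<Rightarrow> (nat \<Rightarrow> complex) \<Rightarrow> complex^'n" where
  "combination m u v i \<alpha> y z =
     \<alpha> *s u i + (\<Sum>k\<in>{1..m} - {i}. y k *s u k) + (\<Sum>k=m+1..CARD('n). z k *s v k)"

end

theory Submission
  imports Defs
begin

text \<open>
  Two exact identities for Keldysh's decomposition drive the estimates.

  \<^item> For \<open>\<rho>\<close> in \<open>D\<close> the contour integral is \<open>F_ci(\<rho>) = I - H(\<rho>) T(\<rho>)\<close> (\<open>F_ci_eq\<close>).  Insert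
    \<open>T(\<xi>)\<^sup>-\<^sup>1 = U (\<xi> I - J)\<^sup>-\<^sup>1 W\<^sup>H + H(\<xi>)\<close>: the holomorphic part is evaluated by Cauchy's formula, and
    each polar part contributes the integral of \<open>1 / ((\<xi> - \<lambda>\<^sub>k) (\<xi> - \<rho>))\<close>, whose two residues cancel
    because \<open>\<lambda>\<^sub>k\<close> and \<open>\<rho>\<close> both lie inside the curve (if they coincide, the double pole has no residue).

  \<^item> The columns \<open>v\<^sub>k\<close> of \<open>U_out\<close> are orthogonal to every \<open>u\<^sub>i\<close>, so \<open>v\<^sub>k\<^sup>H\<close> annihilates the polar part
    and \<open>v\<^sub>k\<^sup>H H(\<rho>) T(\<rho>) = v\<^sub>k\<^sup>H\<close> (\<open>hdot_out_H_T\<close>); at the eigenvalues this follows by continuity.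

  Since \<open>T(\<lambda>\<^sub>i) u\<^sub>i = 0\<close>, the residual \<open>T(\<rho>) x\<close> is \<open>O(\<epsilon>)\<close>.  The first identity gives
  \<open>F_nl(\<rho>) x - x = (F_nl(\<rho>) - F_ci(\<rho>)) x - H(\<rho>) T(\<rho>) x = O(\<gamma> + \<epsilon>)\<close>, and linear independence of the
  \<open>u\<^sub>i\<close> turns this into the bounds for the coefficients of \<open>u\<^sub>i\<close> and of the other eigenvectors.

  The coefficient along \<open>v\<^sub>k\<close> is better because the first-order term cancels.  Put
  \<open>c = \<Sum>\<^sub>j \<omega>\<^sub>j / (\<xi>\<^sub>j - \<rho>)\<close>.  As \<open>v\<^sub>k\<^sup>H\<close> annihilates the polar parts at the nodes,
  \<open>v\<^sub>k\<^sup>H F_nl(\<rho>) x = c v\<^sub>k\<^sup>H x - v\<^sub>k\<^sup>H H_quad(\<rho>) T(\<rho>) x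
     = (c - 1) v\<^sub>k\<^sup>H x - v\<^sub>k\<^sup>H (H_quad(\<rho>) - H(\<rho>)) T(\<rho>) x\<close>.
  The same identity at \<open>x = v\<^sub>k\<close>, together with \<open>v\<^sub>k\<^sup>H F_ci(\<rho>) = 0\<close>, shows \<open>c - 1 = O(\<gamma>)\<close>, and \<open>v\<^sub>k\<^sup>H x\<close> and
  \<open>T(\<rho>) x\<close> are \<open>O(\<epsilon>)\<close>, so the whole expression is \<open>O(\<gamma> \<epsilon>)\<close> (\<open>out_estimate_off_nodes\<close>).  When \<open>\<rho>\<close> is a
  node, this estimate is obtained as a limit from neighbouring points (\<open>out_estimate\<close>).

  The curve is only rectifiable and the integral a Riemann--Stieltjes limit.  The lemma
  \<open>rectifiable_loop_replacement\<close> replaces it by the contour integral over a nearby polynomial loop, to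
  which Cauchy's integral formula applies.
\<close>

text \<open>From here on, \<open>$\<close> selects vector components only, not coefficients of power series.\<close>

no_notation fps_nth (infixl "$" 75)

section \<open>Riemann--Stieltjes contour integrals over rectifiable loops\<close>

text \<open>Rectifiability speaks of divisions, the integral of tagged divisions; the bound carries over to the
  latter.\<close>

lemma rectifiable_path_tagged_bound:
  assumes "rectifiable_path g"
  obtains B where "B \<ge> 0"
    "\<And>p. p tagged_division_of {0..1} \<Longrightarrow> (\<Sum>(t, K)\<in>p. norm (g (Sup K) - g (Inf K))) \<le> B"
proof -
  obtain B where B: "\<And>p. p division_of {0..1} \<Longrightarrow> (\<Sum>K\<in>p. norm (g (Sup K) - g (Inf K))) \<le> B"
    using assms unfolding rectifiable_path_def by blast
  have *: "(\<Sum>(t, K)\<in>p. norm (g (Sup K) - g (Inf K))) \<le> B" if p: "p tagged_division_of {0..1}" for p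
  proof -
    \<comment> \<open>an empty interval gets length \<open>0\<close> explicitly, as \<open>Sup {}\<close> and \<open>Inf {}\<close> are unspecified\<close>
    define len where "len = (\<lambda>K. if K = {} then 0 else norm (g (Sup K) - g (Inf K)))"
    have ne: "(t, K) \<in> p \<Longrightarrow> K \<noteq> {}" for t K using p by blast
    have "(\<Sum>(t, K)\<in>p. norm (g (Sup K) - g (Inf K))) = (\<Sum>(t, K)\<in>p. len K)"
      using ne by (intro sum.cong) (auto simp: len_def)
    also have "\<dots> = (\<Sum>K\<in>snd ` p. len K)"
      (* distinct tagged intervals may share their underlying interval, but only a degenerate one *)
    proof (rule sum.over_tagged_division_lemma[OF p])
      fix a b :: real
      assume "box a b = {}"
      then show "len (cbox a b) = 0" by (cases "a = b") (auto simp: len_def)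
    qed
    also have "\<dots> = (\<Sum>K\<in>snd ` p. norm (g (Sup K) - g (Inf K)))"
      using ne by (intro sum.cong) (auto simp: len_def)
    finally have "(\<Sum>(t, K)\<in>p. norm (g (Sup K) - g (Inf K)))
        = (\<Sum>K\<in>snd ` p. norm (g (Sup K) - g (Inf K)))" .
    then show ?thesis using B[OF division_of_tagged_division[OF p]] by simp
  qed
  show thesis
  proof (rule that[of "max B 0"])
    show "max B 0 \<ge> 0" by simp
    show "(\<Sum>(t, K)\<in>p. norm (g (Sup K) - g (Inf K))) \<le> max B 0" if "p tagged_division_of {0..1}" for p
      using *[OF that] by simp
  qed
qed

lemma has_rs_contour_integral_unique:
  assumes "has_rs_contour_integral f I g" "has_rs_contour_integral f J g"
  shows "I = J"
proof (rule ccontr)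
  assume "I \<noteq> J"
  define e where "e = norm (I - J) / 2"
  have "e > 0" using \<open>I \<noteq> J\<close> by (simp add: e_def)
  obtain d1 where d1: "d1 > 0" "\<And>p. p tagged_division_of {0..1} \<Longrightarrow> (\<lambda>t. ball t d1) fine p \<Longrightarrow>
        norm ((\<Sum>(t, K)\<in>p. f (g t) * (g (Sup K) - g (Inf K))) - I) < e"
    using assms(1) \<open>e > 0\<close> unfolding has_rs_contour_integral_def by meson
  obtain d2 where d2: "d2 > 0" "\<And>p. p tagged_division_of {0..1} \<Longrightarrow> (\<lambda>t. ball t d2) fine p \<Longrightarrow>
        norm ((\<Sum>(t, K)\<in>p. f (g t) * (g (Sup K) - g (Inf K))) - J) < e"
    using assms(2) \<open>e > 0\<close> unfolding has_rs_contour_integral_def by meson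
  have "gauge (\<lambda>t::real. ball t (min d1 d2))" using d1 d2 by (simp add: gauge_def)
  then obtain p where p: "p tagged_division_of {0..1::real}" "(\<lambda>t. ball t (min d1 d2)) fine p"
    by (rule fine_division_exists_real)
  let ?s = "\<Sum>(t, K)\<in>p. f (g t) * (g (Sup K) - g (Inf K))"
  have "(\<lambda>t. ball t d1) fine p" "(\<lambda>t. ball t d2) fine p"
    using p(2) unfolding fine_def by (auto simp: subset_eq; force)+
  then have "norm (?s - I) < e" "norm (?s - J) < e" using d1 d2 p by auto
  then have "norm (I - J) < 2 * e" using norm_triangle_ineq[of "?s - J" "I - ?s"]
    by (simp add: norm_minus_commute)
  then show False by (simp add: e_def)
qed

lemma rs_contour_integral_eq:
  "has_rs_contour_integral f I g \<Longrightarrow> rs_contour_integral g f = I"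
  unfolding rs_contour_integral_def using has_rs_contour_integral_unique by blast

text \<open>Let \<open>G t\<close> be the integral of \<open>f\<close> along \<open>p\<close> up to the parameter \<open>t\<close>, followed by the segment
  from \<open>p t\<close> to \<open>g t\<close>.  On a short parameter interval everything happens in a disc where \<open>f\<close> has a
  primitive \<open>F\<close>, so \<open>G b - G a = F (g b) - F (g a)\<close>, which differs from the summand
  \<open>f (g t) * (g b - g a)\<close> by at most a small multiple of \<open>norm (g b - g a)\<close>.  The increments of \<open>G\<close>
  telescope to the integral over the loop \<open>p\<close>, and the errors add up to a small multiple of the length
  of \<open>g\<close>.\<close>

lemma has_rs_contour_integral_near_loop:
  fixes g p :: "real \<Rightarrow> complex"
  assumes g: "rectifiable_path g" "pathfinish g = pathstart g"
    and e: "e > 0" "\<And>t. t \<in> {0..1} \<Longrightarrow> ball (g t) e \<subseteq> S"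
    and p: "valid_path p" "pathfinish p = pathstart p"
      "\<And>t. t \<in> {0..1} \<Longrightarrow> norm (p t - g t) < e / 2"
    and f: "f holomorphic_on S" "open S"
  shows "has_rs_contour_integral f (contour_integral p f) g"
  unfolding has_rs_contour_integral_def
proof (intro allI impI)
  fix \<epsilon>0 :: real assume "\<epsilon>0 > 0"
  obtain B where B: "B \<ge> 0"
    "\<And>p. p tagged_division_of {0..1} \<Longrightarrow> (\<Sum>(t, K)\<in>p. norm (g (Sup K) - g (Inf K))) \<le> B"
    using rectifiable_path_tagged_bound[OF g(1)] by blast
  have pg: "path g" using g(1) by (simp add: rectifiable_path_def)
  \<comment> \<open>\<open>B + 1\<close> rather than \<open>B\<close>, since the length bound \<open>B\<close> may be \<open>0\<close>\<close>
  define \<epsilon> where "\<epsilon> = \<epsilon>0 / (B + 1)"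
  have \<epsilon>: "\<epsilon> > 0" "\<epsilon> * B < \<epsilon>0" using \<open>\<epsilon>0 > 0\<close> B(1) by (auto simp: \<epsilon>_def field_simps)
  \<comment> \<open>a compact neighbourhood of the curve, on which \<open>f\<close> is uniformly continuous\<close>
  define X where "X = {x. infdist x (path_image g) \<le> e / 2}"
  have X: "compact X" "X \<subseteq> S"
  proof -
    show "compact X" unfolding X_def
      by (rule compact_infdist_le) (use compact_path_image[OF pg] path_image_nonempty e(1) in auto)
    show "X \<subseteq> S"
    proof
      fix x assume "x \<in> X"
      obtain y where y: "y \<in> path_image g" "infdist x (path_image g) = dist x y"
        using infdist_attains_inf[OF compact_imp_closed[OF compact_path_image[OF pg]], of x]
          path_image_nonempty by (metis)
      with \<open>x \<in> X\<close> e(1) have "x \<in> ball y e" by (auto simp: X_def dist_commute)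
      with y(1) show "x \<in> S" using e(2) unfolding path_image_def by blast
    qed
  qed
  have "uniformly_continuous_on X f"
    using compact_uniformly_continuous[OF holomorphic_on_imp_continuous_on[OF holomorphic_on_subset]]
      f(1) X by blast
  then obtain \<eta> where \<eta>: "\<eta> > 0" "\<And>x y. x \<in> X \<Longrightarrow> y \<in> X \<Longrightarrow> dist x y < \<eta> \<Longrightarrow> dist (f x) (f y) < \<epsilon>"
    unfolding uniformly_continuous_on_def using \<epsilon>(1) by (metis dist_commute)
  define r where "r = min \<eta> (e / 2)"
  have r: "r > 0" using \<eta> e by (simp add: r_def)
  have near: "norm (f w - f (g t)) \<le> \<epsilon>" if "t \<in> {0..1}" "w \<in> ball (g t) r" for t w
  proof -
    have "infdist w (path_image g) \<le> dist w (g t)"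
      using that by (intro infdist_le) (auto simp: path_image_def)
    then have "w \<in> X" using that by (auto simp: X_def r_def dist_commute)
    moreover have "g t \<in> X" using that e(1) by (auto simp: X_def path_image_def)
    ultimately have "dist (f w) (f (g t)) < \<epsilon>"
      using that by (intro \<eta>(2)) (auto simp: r_def dist_commute)
    then show ?thesis by (simp add: dist_norm)
  qed
  have "uniformly_continuous_on {0..1} g"
    using compact_uniformly_continuous pg by (auto simp: path_def)
  then obtain d where d: "d > 0"
    "\<And>s t. s \<in> {0..1} \<Longrightarrow> t \<in> {0..1} \<Longrightarrow> dist s t < d \<Longrightarrow> dist (g s) (g t) < r"
    unfolding uniformly_continuous_on_def using r by (metis dist_commute)

  have pS: "path_image p \<subseteq> S"
  proof
    fix x assume "x \<in> path_image p"
    then obtain t where "t \<in> {0..1}" "x = p t" by (auto simp: path_image_def)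
    then have "x \<in> ball (g t) e" using p(3)[of t] e(1) by (auto simp: dist_norm norm_minus_commute)
    then show "x \<in> S" using e(2) \<open>t \<in> {0..1}\<close> by blast
  qed
  have int: "f contour_integrable_on p"
    using contour_integrable_holomorphic_simple[OF f p(1) pS] .
  define G where "G = (\<lambda>t. contour_integral (subpath 0 t p) f
                             + contour_integral (linepath (p t) (g t)) f)"
  have local: "norm (f (g t) * (g b - g a) - (G b - G a)) \<le> \<epsilon> * norm (g b - g a)"
    if t: "t \<in> {0..1}" and ab: "0 \<le> a" "a \<le> b" "b \<le> 1" and sub: "{a..b} \<subseteq> ball t d" for t a b
  proof -
    have *: "g s \<in> ball (g t) r" "p s \<in> ball (g t) e" if "s \<in> {a..b}" for s
    proof -
      have s: "s \<in> {0..1}" using that ab by auto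
      have "dist s t < d" using sub that by (auto simp: dist_commute)
      then have 1: "dist (g s) (g t) < r" using d s t by blast
      then show "g s \<in> ball (g t) r" by (simp add: dist_commute)
      have "dist (p s) (g s) < e / 2" using p(3)[OF s] by (simp add: dist_norm)
      with 1 have "dist (p s) (g t) < e" using dist_triangle[of "p s" "g t" "g s"] by (simp add: r_def)
      then show "p s \<in> ball (g t) e" by (simp add: dist_commute)
    qed
    have sub_ball: "ball (g t) r \<subseteq> ball (g t) e" using e(1) by (auto simp: r_def)
    have holo: "f holomorphic_on ball (g t) e"
      using f(1) e(2)[OF t] holomorphic_on_subset by blast
    then obtain F where F: "\<And>x. x \<in> ball (g t) e \<Longrightarrow> (F has_field_derivative f x) (at x within ball (g t) e)"
      using holomorphic_convex_primitive'[of "ball (g t) e" f] by auto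
    have "path_image (subpath a b p) \<subseteq> ball (g t) e"
      using * ab by (auto simp: path_image_subpath)
    then have 1: "contour_integral (subpath a b p) f = F (p b) - F (p a)"
      using contour_integral_primitive[OF F, of "subpath a b p"] valid_path_subpath[OF p(1), of a b] ab
      by (auto intro!: contour_integral_unique)
    have seg: "contour_integral (linepath (p s) (g s)) f = F (g s) - F (p s)" if "s \<in> {a..b}" for s
    proof -
      have "closed_segment (p s) (g s) \<subseteq> ball (g t) e"
        using *[OF that] sub_ball by (intro closed_segment_subset) auto
      then show ?thesis
        using contour_integral_primitive[OF F, of "linepath (p s) (g s)"]
        by (auto intro!: contour_integral_unique)
    qed
    have 2: "contour_integral (subpath 0 b p) f
        = contour_integral (subpath 0 a p) f + contour_integral (subpath a b p) f"
      using ab by (intro sym[OF contour_integral_subpath_combine[OF int p(1)]]) auto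
    have G: "G b - G a = F (g b) - F (g a)"
      using seg[of a] seg[of b] ab by (simp add: G_def 1 2)
    have "norm ((F (g b) - f (g t) * g b) - (F (g a) - f (g t) * g a)) \<le> \<epsilon> * norm (g b - g a)"
    proof (rule field_differentiable_bound[where S="ball (g t) r" and f = "\<lambda>w. F w - f (g t) * w"
          and f' = "\<lambda>w. f w - f (g t)"])
      show "((\<lambda>w. F w - f (g t) * w) has_field_derivative f z - f (g t)) (at z within ball (g t) r)"
        if "z \<in> ball (g t) r" for z
        using DERIV_subset[OF F sub_ball] that sub_ball
        by (auto intro!: derivative_eq_intros)
      show "norm (f z - f (g t)) \<le> \<epsilon>" if "z \<in> ball (g t) r" for z
        using near[OF t that] .
    qed (use * ab in auto)
    then show ?thesis by (simp add: G norm_minus_commute algebra_simps)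
  qed

  show "\<exists>d>0. \<forall>P. P tagged_division_of {0..1} \<and> (\<lambda>t. ball t d) fine P \<longrightarrow>
      norm ((\<Sum>(t, K)\<in>P. f (g t) * (g (Sup K) - g (Inf K))) - contour_integral p f) < \<epsilon>0"
  proof (intro exI conjI allI impI)
    show "d > 0" by fact
    fix P assume P: "P tagged_division_of {0..1::real} \<and> (\<lambda>t. ball t d) fine P"
    have "G 1 - G 0 = contour_integral p f"
      using p(2) g(2) by (simp add: G_def pathfinish_def pathstart_def)
    then have tot: "(\<Sum>(t, K)\<in>P. G (Sup K) - G (Inf K)) = contour_integral p f"
      using additive_tagged_division_1[of 0 1 P G] P by simp
    have "norm ((\<Sum>(t, K)\<in>P. f (g t) * (g (Sup K) - g (Inf K))) - contour_integral p f)
        = norm (\<Sum>(t, K)\<in>P. f (g t) * (g (Sup K) - g (Inf K)) - (G (Sup K) - G (Inf K)))"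
      unfolding tot[symmetric] by (simp add: sum_subtractf[symmetric] case_prod_unfold)
    also have "\<dots> \<le> (\<Sum>(t, K)\<in>P. \<epsilon> * norm (g (Sup K) - g (Inf K)))"
    proof (rule order_trans[OF norm_sum], rule sum_mono, clarify)
      fix t K assume tK: "(t, K) \<in> P"
      obtain a b where K: "K = cbox a b" using P tK by blast
      have "t \<in> K" "K \<subseteq> {0..1}" "K \<subseteq> ball t d"
        using P tK by (auto simp: fine_def)
      then have "a \<le> b" "0 \<le> a" "b \<le> 1" "t \<in> {0..1}" "{a..b} \<subseteq> ball t d" using K by auto
      then show "norm (f (g t) * (g (Sup K) - g (Inf K)) - (G (Sup K) - G (Inf K)))
            \<le> \<epsilon> * norm (g (Sup K) - g (Inf K))"
        using local[of t a b] K by simp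
    qed
    also have "\<dots> = \<epsilon> * (\<Sum>(t, K)\<in>P. norm (g (Sup K) - g (Inf K)))"
      by (simp add: sum_distrib_left case_prod_unfold)
    also have "\<dots> \<le> \<epsilon> * B" using B(2) P \<epsilon>(1) by (intro mult_left_mono) auto
    also have "\<dots> < \<epsilon>0" by fact
    finally show "norm ((\<Sum>(t, K)\<in>P. f (g t) * (g (Sup K) - g (Inf K))) - contour_integral p f) < \<epsilon>0" .
  qed
qed

text \<open>One loop \<open>p\<close> serves all functions holomorphic on \<open>S\<close>, and it is homotopic to \<open>g\<close> within \<open>S\<close>, so that
  the two have the same winding numbers about all points outside \<open>S\<close>.\<close>

lemma rectifiable_loop_replacement:
  fixes g :: "real \<Rightarrow> complex"
  assumes g: "rectifiable_path g" "pathfinish g = pathstart g"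
    and S: "open S" "path_image g \<subseteq> S"
  obtains p where "valid_path p" "pathfinish p = pathstart p" "path_image p \<subseteq> S"
    "homotopic_loops S g p"
    "\<And>f. f holomorphic_on S \<Longrightarrow> has_rs_contour_integral f (contour_integral p f) g"
proof -
  have pg: "path g" using g(1) by (simp add: rectifiable_path_def)
  obtain d where d: "d > 0"
    "\<And>h. path h \<Longrightarrow> pathfinish h = pathstart h \<Longrightarrow>
       (\<forall>t \<in> {0..1}. norm(h t - g t) < d) \<Longrightarrow> homotopic_loops S g h"
    using homotopic_nearby_loops[OF pg S g(2)] by blast
  obtain e where e: "e > 0" "(\<Union>x\<in>path_image g. ball x e) \<subseteq> S"
    using compact_subset_open_imp_ball_epsilon_subset[OF compact_path_image[OF pg] S] .
  then have e': "\<And>t. t \<in> {0..1} \<Longrightarrow> ball (g t) e \<subseteq> S"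
    by (force simp: path_image_def)
  obtain p where p: "polynomial_function p" "pathstart p = pathstart g" "pathfinish p = pathfinish g"
     "\<And>t. t \<in> {0..1} \<Longrightarrow> norm(p t - g t) < min d (e / 2)"
    using path_approx_polynomial_function[OF pg, of "min d (e/2)"] d e by auto
  have vp: "valid_path p" using p(1) by (rule valid_path_polynomial_function)
  have loop: "pathfinish p = pathstart p" using p g by simp
  have hom: "homotopic_loops S g p"
    using d(2)[OF valid_path_imp_path[OF vp] loop] p(4) by simp
  show thesis
  proof (rule that[OF vp loop _ hom])
    show "path_image p \<subseteq> S" using homotopic_loops_imp_subset[OF hom] by simp
    show "has_rs_contour_integral f (contour_integral p f) g" if "f holomorphic_on S" for f
      using has_rs_contour_integral_near_loop[OF g e(1) e' vp loop _ that S(1)] p(4) by auto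
  qed
qed

section \<open>Holomorphic matrix functions and the Hermitian product\<close>

lemma matrix_inv_inverse:
  fixes A :: "complex^'n^'n"
  assumes "invertible A"
  shows "A ** matrix_inv A = mat 1" "matrix_inv A ** A = mat 1"
  using someI_ex[of "\<lambda>A'. A ** A' = mat 1 \<and> A' ** A = mat 1"] assms
  unfolding invertible_def matrix_inv_def by auto

lemma not_invertible_imp_kernel:
  fixes A :: "complex^'n^'n"
  assumes "\<not> invertible A"
  obtains x where "x \<noteq> 0" "A *v x = 0"
  using assms matrix_left_invertible_ker[of A] invertible_left_inverse[of A] by auto

lemma matrix_diff_ldistrib: "A ** (B - C) = A ** B - A ** (C :: complex^'n^'n)"
  by (simp add: matrix_matrix_mult_def vec_eq_iff right_diff_distrib sum_subtractf)

text \<open>Cramer's rule exhibits the entries of the inverse as quotients of determinants, hence as holomorphic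
  functions wherever the matrix is holomorphic and invertible.\<close>

lemma matrix_inv_cramer:
  fixes A :: "complex^'n^'n"
  assumes "invertible A"
  shows "matrix_inv A $ a $ b = det (\<chi> i j. if j = a then axis b 1 $ i else A $ i $ j) / det A"
proof -
  have "A *v column b (matrix_inv A) = axis b 1"
  proof -
    have "column b (matrix_inv A) = matrix_inv A *v axis b 1"
      by (simp add: column_def matrix_vector_mult_def vec_eq_iff axis_def if_distrib cong: if_cong)
    then show ?thesis by (simp add: matrix_vector_mul_assoc matrix_inv_inverse(1)[OF assms])
  qed
  then have "column b (matrix_inv A) = (\<chi> k. det (\<chi> i j. if j = k then axis b 1 $ i else A $ i $ j) / det A)"
    using cramer assms invertible_det_nz by blast
  then show ?thesis by (simp add: column_def vec_eq_iff)
qed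

lemma det_holomorphic:
  assumes "mat_holomorphic_on A S"
  shows "(\<lambda>z. det (A z)) holomorphic_on S"
  using assms unfolding det_def mat_holomorphic_on_def
  by (auto intro!: holomorphic_intros)

lemma matrix_inv_holomorphic:
  assumes T: "mat_holomorphic_on T S" and inv: "\<And>z. z \<in> S \<Longrightarrow> invertible (T z)"
  shows "mat_holomorphic_on (\<lambda>z. matrix_inv (T z)) S"
  unfolding mat_holomorphic_on_def
proof (intro allI)
  fix a b
  have "mat_holomorphic_on (\<lambda>z. \<chi> i j. if j = a then axis b 1 $ i else T z $ i $ j) S"
    unfolding mat_holomorphic_on_def
  proof (intro allI)
    fix i j
    show "(\<lambda>z. (\<chi> i j. if j = a then axis b 1 $ i else T z $ i $ j) $ i $ j) holomorphic_on S"
      using T by (cases "j = a") (simp_all add: mat_holomorphic_on_def)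
  qed
  then have "(\<lambda>z. det (\<chi> i j. if j = a then axis b 1 $ i else T z $ i $ j) / det (T z)) holomorphic_on S"
    using T inv invertible_det_nz by (intro holomorphic_on_divide det_holomorphic) auto
  then show "(\<lambda>z. matrix_inv (T z) $ a $ b) holomorphic_on S"
    using inv by (subst holomorphic_cong[OF refl]) (auto simp: matrix_inv_cramer)
qed

lemma open_invertible:
  assumes "mat_holomorphic_on T \<Omega>" "open \<Omega>"
  shows "open {z \<in> \<Omega>. invertible (T z)}"
proof -
  have "{z \<in> \<Omega>. invertible (T z)} = \<Omega> \<inter> (\<lambda>z. det (T z)) -` (- {0})"
    by (auto simp: invertible_det_nz)
  moreover have "open (\<Omega> \<inter> (\<lambda>z. det (T z)) -` (- {0}))"
    using holomorphic_on_imp_continuous_on[OF det_holomorphic[OF assms(1)]] assms(2)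
    by (rule continuous_open_preimage) (simp add: open_Compl)
  ultimately show ?thesis by simp
qed

lemma tendsto_matrix:
  fixes A :: "_ \<Rightarrow> complex^'n^'n"
  assumes "\<And>a b. ((\<lambda>x. A x $ a $ b) \<longlongrightarrow> B $ a $ b) F"
  shows "(A \<longlongrightarrow> B) F"
  using assms by (intro vec_tendstoI)

lemma tendsto_matrix_mult [tendsto_intros]:
  fixes A B :: "_ \<Rightarrow> complex^'n^'n"
  assumes "(A \<longlongrightarrow> A') F" "(B \<longlongrightarrow> B') F"
  shows "((\<lambda>x. A x ** B x) \<longlongrightarrow> A' ** B') F"
  using assms by (intro tendsto_matrix) (auto simp: matrix_matrix_mult_def intro!: tendsto_intros)

lemma tendsto_matrix_vector_mult [tendsto_intros]:
  fixes A :: "_ \<Rightarrow> complex^'n^'n"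
  assumes "(A \<longlongrightarrow> A') F" "(x \<longlongrightarrow> x') F"
  shows "((\<lambda>t. A t *v x t) \<longlongrightarrow> A' *v x') F"
  using assms by (intro vec_tendstoI) (auto simp: matrix_vector_mult_def intro!: tendsto_intros)

lemma tendsto_mat_scale [tendsto_intros]:
  fixes A :: "_ \<Rightarrow> complex^'n^'n"
  assumes "(c \<longlongrightarrow> c') F" "(A \<longlongrightarrow> A') F"
  shows "((\<lambda>x. c x *m A x) \<longlongrightarrow> c' *m A') F"
  using assms by (intro tendsto_matrix) (auto simp: mat_scale_def intro!: tendsto_intros)

lemma tendsto_hdot [tendsto_intros]:
  assumes "(x \<longlongrightarrow> x') F"
  shows "((\<lambda>t. hdot a (x t)) \<longlongrightarrow> hdot a x') F"
  unfolding hdot_def by (intro tendsto_intros assms)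

lemma mat_holomorphic_tendsto:
  assumes "mat_holomorphic_on T \<Omega>" "open \<Omega>" "z \<in> \<Omega>"
  shows "(T \<longlongrightarrow> T z) (at z)"
proof (rule tendsto_matrix)
  fix a b
  have "continuous_on \<Omega> (\<lambda>z. T z $ a $ b)"
    using assms(1) holomorphic_on_imp_continuous_on by (auto simp: mat_holomorphic_on_def)
  then show "((\<lambda>z. T z $ a $ b) \<longlongrightarrow> T z $ a $ b) (at z)"
    using assms(2,3) continuous_on_eq_continuous_at isCont_def by blast
qed

lemma mat_difference_quotient_tendsto:
  assumes "mat_holomorphic_on T \<Omega>" "open \<Omega>" "z \<in> \<Omega>"
  shows "((\<lambda>\<rho>. (1 / (\<rho> - z)) *m (T \<rho> - T z)) \<longlongrightarrow> mat_deriv T z) (at z)"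
proof (rule tendsto_matrix)
  fix a b
  have "((\<lambda>z. T z $ a $ b) has_field_derivative deriv (\<lambda>z. T z $ a $ b) z) (at z)"
    using assms by (intro holomorphic_derivI[of _ \<Omega>]) (auto simp: mat_holomorphic_on_def)
  then show "((\<lambda>\<rho>. ((1 / (\<rho> - z)) *m (T \<rho> - T z)) $ a $ b) \<longlongrightarrow> mat_deriv T z $ a $ b) (at z)"
    by (simp add: has_field_derivative_iff mat_scale_def mat_deriv_def)
qed

lemma mat_scale_mult_vec: "(c *m A) *v x = c *s (A *v x)"
  by (simp add: mat_scale_def matrix_vector_mult_def vec_eq_iff sum_distrib_left mult.assoc)

lemma sum_matrix_mult_vec: "(\<Sum>j\<in>I. A j) *v x = (\<Sum>j\<in>I. A j *v (x :: complex^'n))"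
  by (induction I rule: infinite_finite_induct) (auto simp: matrix_vector_mult_add_rdistrib)

lemma hdot_simps [simp]:
  "hdot a 0 = 0" "hdot a (x + y) = hdot a x + hdot a y" "hdot a (x - y) = hdot a x - hdot a y"
  "hdot a (c *s x) = c * hdot a x" "hdot a (\<Sum>i\<in>I. f i) = (\<Sum>i\<in>I. hdot a (f i))"
proof -
  show "hdot a 0 = 0" "hdot a (c *s x) = c * hdot a x" "hdot a (x - y) = hdot a x - hdot a y"
    by (auto simp: hdot_def algebra_simps sum_distrib_left sum_subtractf)
  show add: "hdot a (x + y) = hdot a x + hdot a y" for x y
    by (simp add: hdot_def algebra_simps sum.distrib)
  show "hdot a (\<Sum>i\<in>I. f i) = (\<Sum>i\<in>I. hdot a (f i))"
    by (induction I rule: infinite_finite_induct) (auto simp: add, auto simp: hdot_def)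
qed

lemma hdot_commute: "hdot y x = cnj (hdot x y)"
  by (simp add: hdot_def mult.commute)

lemma hdot_self: "hdot x x = of_real ((norm x)\<^sup>2)"
proof -
  have "cnj (x $ a) * x $ a = of_real ((cmod (x $ a))\<^sup>2)" for a
    by (subst complex_norm_square) (rule mult.commute)
  then show ?thesis by (simp add: hdot_def norm_vec_def L2_set_def sum_nonneg)
qed

lemma norm_hdot_le: "cmod (hdot x y) \<le> norm x * norm y"
proof -
  have "cmod (hdot x y) \<le> (\<Sum>a\<in>UNIV. \<bar>cmod (x $ a)\<bar> * \<bar>cmod (y $ a)\<bar>)"
    unfolding hdot_def by (rule order_trans[OF norm_sum]) (simp add: norm_mult)
  also have "\<dots> \<le> norm x * norm y"
    unfolding norm_vec_def by (rule L2_set_mult_ineq)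
  finally show ?thesis .
qed

lemma norm_mult_vec_le_spectral_norm: "norm (A *v x) \<le> spectral_norm A * norm x"
  unfolding spectral_norm_def by (rule onorm) (rule matrix_vector_mul_bounded_linear)

lemma spectral_norm_nonneg: "0 \<le> spectral_norm A"
  unfolding spectral_norm_def by (rule onorm_pos_le) (rule matrix_vector_mul_bounded_linear)

lemma norm_scalar_vec: "norm (c *s x) = cmod c * norm (x :: complex^'n)"
  by (simp add: norm_vec_def norm_mult L2_set_right_distrib)

lemma norm_mult_vec_le_entries:
  fixes A :: "complex^'n^'n"
  shows "norm (A *v x) \<le> (\<Sum>a\<in>UNIV. \<Sum>b\<in>UNIV. cmod (A $ a $ b)) * norm x"
proof -
  have "norm (A *v x) \<le> (\<Sum>a\<in>UNIV. cmod ((A *v x) $ a))"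
    unfolding norm_vec_def by (rule L2_set_le_sum) simp
  also have "\<dots> \<le> (\<Sum>a\<in>UNIV. \<Sum>b\<in>UNIV. cmod (A $ a $ b) * norm x)"
    unfolding matrix_vector_mult_def
    by (auto intro!: sum_mono sum_norm_le mult_left_mono Finite_Cartesian_Product.norm_nth_le
        simp: norm_mult)
  finally show ?thesis by (simp add: sum_distrib_right)
qed

lemma holomorphic_matrix_bounded:
  fixes A :: "complex \<Rightarrow> complex^'n^'n"
  assumes "mat_holomorphic_on A S" "compact X" "X \<subseteq> S"
  obtains M where "M \<ge> 0" "\<And>z x. z \<in> X \<Longrightarrow> norm (A z *v x) \<le> M * norm x"
proof -
  have "\<exists>M. \<forall>z\<in>X. cmod (A z $ a $ b) \<le> M" for a b
  proof -
    have "compact ((\<lambda>z. A z $ a $ b) ` X)"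
      using assms by (intro compact_continuous_image holomorphic_on_imp_continuous_on)
         (auto simp: mat_holomorphic_on_def intro: holomorphic_on_subset)
    then have "bounded ((\<lambda>z. A z $ a $ b) ` X)" by (rule compact_imp_bounded)
    then show ?thesis by (auto simp: bounded_iff)
  qed
  then obtain M where M: "\<And>a b z. z \<in> X \<Longrightarrow> cmod (A z $ a $ b) \<le> M a b" by metis
  show thesis
  proof (rule that[of "\<Sum>a\<in>UNIV. \<Sum>b\<in>UNIV. max 0 (M a b)"])
    show "(\<Sum>a\<in>UNIV. \<Sum>b\<in>UNIV. max 0 (M a b)) \<ge> 0" by (intro sum_nonneg) auto
    fix z x assume "z \<in> X"
    have "norm (A z *v x) \<le> (\<Sum>a\<in>UNIV. \<Sum>b\<in>UNIV. cmod (A z $ a $ b)) * norm x"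
      by (rule norm_mult_vec_le_entries)
    also have "\<dots> \<le> (\<Sum>a\<in>UNIV. \<Sum>b\<in>UNIV. max 0 (M a b)) * norm x"
      using M[OF \<open>z \<in> X\<close>] by (intro mult_right_mono sum_mono) (auto simp: le_max_iff_disj)
    finally show "norm (A z *v x) \<le> (\<Sum>a\<in>UNIV. \<Sum>b\<in>UNIV. max 0 (M a b)) * norm x" .
  qed
qed

text \<open>For each \<open>k\<close> a linear map sends \<open>u k\<close> to itself and the other basis vectors to \<open>0\<close>; applied to a linear
  combination it isolates the \<open>k\<close>-th coefficient, which its spectral norm therefore bounds.\<close>

lemma independent_coefficient_bound:
  fixes u :: "nat \<Rightarrow> complex^'n"
  assumes "inj_on u S" "vec.independent (u ` S)" "finite S" "\<And>k. k \<in> S \<Longrightarrow> norm (u k) = 1"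
  obtains C where "C > 0" "\<And>c k. k \<in> S \<Longrightarrow> cmod (c k) \<le> C * norm (\<Sum>j\<in>S. c j *s u j)"
proof -
  have "\<exists>A :: complex^'n^'n. \<forall>j\<in>S. A *v u j = (if j = k then u k else 0)" if "k \<in> S" for k
  proof -
    obtain h where h: "Vector_Spaces.linear (*s) (*s) h"
      "\<forall>x\<in>u ` S. h x = (if x = u k then u k else (0 :: complex^'n))"
      using vec.linear_independent_extend[OF assms(2), of "\<lambda>x. if x = u k then u k else 0"] by blast
    then have "\<forall>j\<in>S. matrix h *v u j = (if j = k then u k else 0)"
      using assms(1) that by (auto simp: matrix_works inj_on_def)
    then show ?thesis by blast
  qed
  then obtain A :: "nat \<Rightarrow> complex^'n^'n" where
    A: "\<And>j k. k \<in> S \<Longrightarrow> j \<in> S \<Longrightarrow> A k *v u j = (if j = k then u k else 0)"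
    by metis
  define C where "C = (\<Sum>k\<in>S. spectral_norm (A k)) + 1"
  show thesis
  proof (rule that[of C])
    show "C > 0" unfolding C_def by (intro add_nonneg_pos sum_nonneg spectral_norm_nonneg) simp
    fix c :: "nat \<Rightarrow> complex" and k assume k: "k \<in> S"
    have "A k *v (\<Sum>j\<in>S. c j *s u j) = (\<Sum>j\<in>S. c j *s (A k *v u j))"
      by (simp add: vec.linear_sum[OF matrix_vector_mul_linear_gen] vec.linear_scale[OF matrix_vector_mul_linear_gen])
    also have "\<dots> = (\<Sum>j\<in>S. if j = k then c k *s u k else 0)"
      using A[OF k] by (intro sum.cong) auto
    also have "\<dots> = c k *s u k" using k assms(3) by simp
    finally have "cmod (c k) = norm (A k *v (\<Sum>j\<in>S. c j *s u j))"
      using assms(4)[OF k] by (simp add: norm_scalar_vec)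
    also have "\<dots> \<le> spectral_norm (A k) * norm (\<Sum>j\<in>S. c j *s u j)"
      by (rule norm_mult_vec_le_spectral_norm)
    also have "\<dots> \<le> C * norm (\<Sum>j\<in>S. c j *s u j)"
    proof (rule mult_right_mono)
      have "spectral_norm (A k) \<le> (\<Sum>k\<in>S. spectral_norm (A k))"
        by (rule member_le_sum[OF k]) (use assms(3) spectral_norm_nonneg in auto)
      then show "spectral_norm (A k) \<le> C" by (simp add: C_def)
    qed simp
    finally show "cmod (c k) \<le> C * norm (\<Sum>j\<in>S. c j *s u j)" .
  qed
qed

section \<open>The contour integral in terms of the holomorphic part\<close>

locale keldysh_problem =
  fixes T H :: "complex \<Rightarrow> complex^'n^'n"
    and \<Omega> D D0 :: "complex set"
    and g :: "real \<Rightarrow> complex"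
    and m :: nat
    and lam :: "nat \<Rightarrow> complex"
    and u v w :: "nat \<Rightarrow> complex^'n"
  assumes jordan: "simple_path g" "pathfinish g = pathstart g" "rectifiable_path g"
    and D: "D = inside (path_image g)"
    and oriented: "\<And>z. z \<in> D \<Longrightarrow> winding_number g z = 1"
    and domain: "open \<Omega>" "closure D \<subseteq> \<Omega>"
    and holo: "mat_holomorphic_on T \<Omega>"
    and boundary: "\<And>\<xi>. \<xi> \<in> path_image g \<Longrightarrow> invertible (T \<xi>)"
    and eigenvalues: "lam ` {1..m} = {z \<in> D. \<exists>x. eigenpair T z x}"
    and eigenvectors: "\<And>i. i \<in> {1..m} \<Longrightarrow> eigenpair T (lam i) (u i)"
      "\<And>i. i \<in> {1..m} \<Longrightarrow> norm (u i) = 1"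
    and independent: "inj_on u {1..m}" "vec.independent (u ` {1..m})"
    and decomposition: "keldysh T \<Omega> D m lam u w H"
    and out: "orthonormal_basis_of_complement m u v"
    and D0: "compact D0" "D0 \<subseteq> D" "\<And>i. i \<in> {1..m} \<Longrightarrow> lam i \<in> interior D0"
begin

definition regular_set :: "complex set" where
  "regular_set = {z \<in> \<Omega>. invertible (T z)}"

lemma open_regular_set: "open regular_set"
  unfolding regular_set_def using holo domain(1) by (rule open_invertible)

lemma open_D: "open D"
  unfolding D using Jordan_inside_outside[OF jordan(1,2)] by blast

lemma D_subset: "D \<subseteq> \<Omega>"
  using domain(2) closure_subset by blast

lemma path_image_subset: "path_image g \<subseteq> regular_set"
proof -
  have "path_image g = frontier D"
    unfolding D using Jordan_inside_outside[OF jordan(1,2)] by simp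
  then have "path_image g \<subseteq> \<Omega>" using domain(2) by (auto simp: frontier_def)
  then show ?thesis using boundary by (auto simp: regular_set_def)
qed

lemma eigenvalue_in_D: "k \<in> {1..m} \<Longrightarrow> lam k \<in> D"
  using eigenvalues by blast

lemma eigenvalue_not_regular:
  assumes "k \<in> {1..m}"
  shows "lam k \<notin> regular_set"
proof
  assume "lam k \<in> regular_set"
  then have "matrix_inv (T (lam k)) *v (T (lam k) *v u k) = u k"
    by (simp add: matrix_vector_mul_assoc matrix_inv_inverse regular_set_def)
  then show False using eigenvectors(1)[OF assms] by (simp add: eigenpair_def)
qed

lemma D_regular:
  assumes "z \<in> D" "z \<notin> lam ` {1..m}"
  shows "z \<in> regular_set"
proof -
  have "invertible (T z)"
  proof (rule ccontr)
    assume "\<not> invertible (T z)"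
    then obtain x where "x \<noteq> 0" "T z *v x = 0" by (rule not_invertible_imp_kernel)
    then have "z \<in> {z \<in> D. \<exists>x. eigenpair T z x}" using assms(1) by (auto simp: eigenpair_def)
    then show False using assms(2) eigenvalues by simp
  qed
  then show ?thesis using assms(1) D_subset by (auto simp: regular_set_def)
qed

lemma matrix_inv_regular:
  "z \<in> regular_set \<Longrightarrow> matrix_inv (T z) = polar_part m lam u w z + H z"
  using decomposition by (simp add: keldysh_def regular_set_def)

text \<open>Keldysh's formula extends \<open>H\<close> holomorphically from \<open>D\<close> to the regular set, which contains the
  boundary curve.  This makes Cauchy's integral formula applicable to \<open>H\<close> with integration over that
  curve.\<close>

lemma H_holomorphic: "mat_holomorphic_on H (D \<union> regular_set)"
  unfolding mat_holomorphic_on_def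
proof (intro allI)
  fix a b
  have "mat_holomorphic_on (\<lambda>z. matrix_inv (T z)) regular_set"
    using holo by (intro matrix_inv_holomorphic)
      (auto simp: regular_set_def mat_holomorphic_on_def intro: holomorphic_on_subset)
  then have 1: "(\<lambda>z. matrix_inv (T z) $ a $ b) holomorphic_on regular_set"
    by (simp add: mat_holomorphic_on_def)
  have 2: "(\<lambda>z. polar_part m lam u w z $ a $ b) holomorphic_on regular_set"
    unfolding polar_part_def using eigenvalue_not_regular by (auto intro!: holomorphic_intros)
  have "(\<lambda>z. H z $ a $ b) holomorphic_on regular_set"
    by (rule holomorphic_transform[OF holomorphic_on_diff[OF 1 2]]) (simp add: matrix_inv_regular)
  moreover have "(\<lambda>z. H z $ a $ b) holomorphic_on D"
    using decomposition by (simp add: keldysh_def mat_holomorphic_on_def)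
  ultimately show "(\<lambda>z. H z $ a $ b) holomorphic_on D \<union> regular_set"
    using open_D open_regular_set by (intro holomorphic_on_Un)
qed

lemma T_tendsto: "z \<in> \<Omega> \<Longrightarrow> (T \<longlongrightarrow> T z) (at z)"
  using mat_holomorphic_tendsto holo domain(1) by blast

lemma H_tendsto: "z \<in> D \<Longrightarrow> (H \<longlongrightarrow> H z) (at z)"
  using mat_holomorphic_tendsto[OF H_holomorphic] open_D open_regular_set by blast

text \<open>The integrand splits into \<open>1 / (\<xi> - \<rho>)\<close>, the terms \<open>H(\<xi>) T(\<rho>) / (\<xi> - \<rho>)\<close>, and multiples of
  \<open>1 / ((\<xi> - \<lambda>\<^sub>k) (\<xi> - \<rho>))\<close>.  The first two are evaluated by Cauchy's formula; the last integrate to \<open>0\<close>,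
  by partial fractions for \<open>\<rho> \<noteq> \<lambda>\<^sub>k\<close> and by a primitive for \<open>\<rho> = \<lambda>\<^sub>k\<close>.\<close>

lemma F_ci_eq:
  assumes "\<rho> \<in> D"
  shows "F_ci T g \<rho> = mat 1 - H \<rho> ** T \<rho>"
proof -
  \<comment> \<open>the eigenvalues are not regular points, so \<open>S\<close> avoids all poles of the integrand\<close>
  define S where "S = regular_set - {\<rho>}"
  have S: "open S" using open_regular_set by (auto simp: S_def)
  have "\<rho> \<notin> path_image g" using assms by (simp add: D inside_def)
  then have gS: "path_image g \<subseteq> S" using path_image_subset by (auto simp: S_def)
  obtain p where p: "valid_path p" "pathfinish p = pathstart p" "path_image p \<subseteq> S"
    and hom: "homotopic_loops S g p"
    and rs: "\<And>f. f holomorphic_on S \<Longrightarrow> has_rs_contour_integral f (contour_integral p f) g"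
    using rectifiable_loop_replacement[OF jordan(3,2) S gS] by blast
  have wn: "winding_number p z = winding_number g z" if "z \<notin> S" for z
    using winding_number_homotopic_loops[OF homotopic_loops_subset[OF hom]] that by auto
  have wn1: "winding_number p z = 1" if "z \<in> D" "z \<notin> S" for z
    using wn oriented that by simp
  have wn0: "winding_number p z = 0" if "z \<notin> D \<union> regular_set" for z
  proof -
    have "z \<notin> path_image g" using path_image_subset that by auto
    then have "z \<in> outside (path_image g)"
      using inside_Un_outside[of "path_image g"] that unfolding D by blast
    then have "winding_number g z = 0"
      using winding_number_zero_in_outside jordan simple_path_imp_path by blast
    then show ?thesis using wn that by (simp add: S_def)
  qed
  have lamS: "lam k \<notin> S" "lam k \<in> D" if "k \<in> {1..m}" for k
    using eigenvalue_not_regular eigenvalue_in_D that by (auto simp: S_def)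
  have \<rho>S: "\<rho> \<notin> S" by (simp add: S_def)
  have cauchy: "((\<lambda>\<xi>. f \<xi> / (\<xi> - z)) has_contour_integral (2 * of_real pi * \<i> * f z)) p"
    if "f holomorphic_on (D \<union> regular_set)" "z \<in> D" "z \<notin> S" for f z
    using Cauchy_integral_formula_global[OF _ that(1) _ p(1) _ p(2) wn0, of z]
      that p(3) open_D open_regular_set wn1[of z] by (auto simp: S_def)
  have pole: "((\<lambda>\<xi>. 1 / (\<xi> - lam k) * (1 / (\<xi> - \<rho>))) has_contour_integral 0) p"
    if k: "k \<in> {1..m}" for k
  proof (cases "lam k = \<rho>")
    case True
    have "((\<lambda>\<xi>. - (1 / (\<xi> - \<rho>))) has_field_derivative 1 / (\<xi> - lam k) * (1 / (\<xi> - \<rho>))) (at \<xi> within S)"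
      if "\<xi> \<in> S" for \<xi>
      using that True by (auto intro!: derivative_eq_intros simp: S_def power2_eq_square)
    then show ?thesis by (rule Cauchy_theorem_primitive[OF _ p(1,3,2)])
  next
    case False
    have "((\<lambda>\<xi>. 1 / (lam k - \<rho>) * (1 / (\<xi> - lam k) - 1 / (\<xi> - \<rho>))) has_contour_integral
            1 / (lam k - \<rho>) * (2 * of_real pi * \<i> * 1 - 2 * of_real pi * \<i> * 1)) p"
      using cauchy[of "\<lambda>_. 1"] lamS[OF k] assms \<rho>S
      by (intro has_contour_integral_lmul has_contour_integral_diff) auto
    moreover have "1 / (lam k - \<rho>) * (1 / (\<xi> - lam k) - 1 / (\<xi> - \<rho>)) = 1 / (\<xi> - lam k) * (1 / (\<xi> - \<rho>))"
      if "\<xi> \<in> path_image p" for \<xi>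
    proof -
      have "\<xi> \<noteq> lam k" "\<xi> \<noteq> \<rho>" using p(3) that lamS(1)[OF k] \<rho>S by auto
      then show ?thesis using False by (simp add: field_simps)
    qed
    ultimately show ?thesis using has_contour_integral_eq by fastforce
  qed
  have entry: "rs_contour_integral g (\<lambda>\<xi>. ((1 / (\<xi> - \<rho>)) *m (mat 1 - matrix_inv (T \<xi>) ** T \<rho>)) $ a $ b)
      = 2 * of_real pi * \<i> * (mat 1 - H \<rho> ** T \<rho>) $ a $ b" for a b
  proof -
    let ?f = "\<lambda>\<xi>. ((1 / (\<xi> - \<rho>)) *m (mat 1 - matrix_inv (T \<xi>) ** T \<rho>)) $ a $ b"
    let ?h = "\<lambda>\<xi>. (mat 1 :: complex^'n^'n) $ a $ b * (1 / (\<xi> - \<rho>))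
       - (\<Sum>c\<in>UNIV. T \<rho> $ c $ b * (H \<xi> $ a $ c / (\<xi> - \<rho>)
           + (\<Sum>k=1..m. (u k $ a * cnj (w k $ c)) * (1 / (\<xi> - lam k) * (1 / (\<xi> - \<rho>))))))"
    have "(?h has_contour_integral
       ((mat 1 :: complex^'n^'n) $ a $ b * (2 * of_real pi * \<i> * 1)
       - (\<Sum>c\<in>UNIV. T \<rho> $ c $ b * (2 * of_real pi * \<i> * H \<rho> $ a $ c
           + (\<Sum>k=1..m. (u k $ a * cnj (w k $ c)) * 0))))) p"
      using H_holomorphic assms \<rho>S unfolding mat_holomorphic_on_def
      by (intro has_contour_integral_diff has_contour_integral_lmul has_contour_integral_add
          has_contour_integral_sum pole cauchy finite_atLeastAtMost finite holomorphic_on_const) auto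
    moreover have "?h \<xi> = ?f \<xi>" if "\<xi> \<in> path_image p" for \<xi>
    proof -
      have "\<xi> \<in> regular_set" using that p(3) by (auto simp: S_def)
      then show ?thesis
        by (simp add: mat_scale_def matrix_matrix_mult_def matrix_inv_regular polar_part_def
            algebra_simps sum_distrib_left sum_distrib_right sum.distrib sum_divide_distrib
            diff_divide_distrib)
    qed
    ultimately have "(?f has_contour_integral
       ((mat 1 :: complex^'n^'n) $ a $ b * (2 * of_real pi * \<i> * 1)
       - (\<Sum>c\<in>UNIV. T \<rho> $ c $ b * (2 * of_real pi * \<i> * H \<rho> $ a $ c
           + (\<Sum>k=1..m. (u k $ a * cnj (w k $ c)) * 0))))) p"
      by (rule has_contour_integral_eq)
    also have "(mat 1 :: complex^'n^'n) $ a $ b * (2 * of_real pi * \<i> * 1)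
       - (\<Sum>c\<in>UNIV. T \<rho> $ c $ b * (2 * of_real pi * \<i> * H \<rho> $ a $ c
           + (\<Sum>k=1..m. (u k $ a * cnj (w k $ c)) * 0)))
       = 2 * of_real pi * \<i> * (mat 1 - H \<rho> ** T \<rho>) $ a $ b"
      by (simp add: matrix_matrix_mult_def algebra_simps sum_distrib_left)
    finally have val: "contour_integral p ?f = 2 * of_real pi * \<i> * (mat 1 - H \<rho> ** T \<rho>) $ a $ b"
      by (rule contour_integral_unique)
    have "?f holomorphic_on S"
    proof -
      have "mat_holomorphic_on (\<lambda>z. matrix_inv (T z)) S"
        using holo by (intro matrix_inv_holomorphic)
          (auto simp: S_def regular_set_def mat_holomorphic_on_def intro: holomorphic_on_subset)
      then show ?thesis
        by (auto simp: mat_scale_def matrix_matrix_mult_def mat_holomorphic_on_def S_def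
            intro!: holomorphic_intros)
    qed
    then show ?thesis unfolding val[symmetric] by (intro rs_contour_integral_eq rs)
  qed
  show ?thesis
    unfolding F_ci_def mat_contour_integral_def entry
    by (simp add: vec_eq_iff mat_scale_def)
qed

section \<open>Components orthogonal to the eigenvectors\<close>

lemma out_orthonormal:
  assumes "k \<in> {m+1..CARD('n)}" "l \<in> {m+1..CARD('n)}"
  shows "hdot (v k) (v l) = (if k = l then 1 else 0)"
  using out assms by (simp add: orthonormal_basis_of_complement_def)

lemma out_orthogonal:
  assumes "k \<in> {m+1..CARD('n)}" "i \<in> {1..m}"
  shows "hdot (v k) (u i) = 0"
proof -
  have "v k \<in> vec.span (v ` {m+1..CARD('n)})" using assms(1) by (intro vec.span_base) auto
  then have "hdot (u i) (v k) = 0"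
    using out assms(2) unfolding orthonormal_basis_of_complement_def by blast
  then show ?thesis by (simp add: hdot_commute[of "v k"])
qed

lemma out_norm: "k \<in> {m+1..CARD('n)} \<Longrightarrow> norm (v k) = 1"
  using out_orthonormal[of k k] hdot_self[of "v k"] norm_ge_zero[of "v k"]
  by (metis of_real_eq_1_iff power2_eq_1_iff neg_0_le_iff_le not_one_le_zero)

lemma hdot_out_le: "k \<in> {m+1..CARD('n)} \<Longrightarrow> cmod (hdot (v k) x) \<le> norm x"
  using norm_hdot_le[of "v k" x] out_norm by simp

lemma hdot_out_combination:
  assumes "k \<in> {m+1..CARD('n)}" "i \<in> {1..m}"
  shows "hdot (v k) (combination m u v i \<alpha> y z) = z k"
proof -
  have "(\<Sum>l=m+1..CARD('n). z l * hdot (v k) (v l)) = (\<Sum>l=m+1..CARD('n). if l = k then z k else 0)"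
    using assms(1) by (intro sum.cong) (auto simp: out_orthonormal)
  also have "\<dots> = z k" using assms(1) by simp
  finally show ?thesis
    using assms by (simp add: combination_def out_orthogonal)
qed

lemma hdot_out_polar_part:
  assumes "k \<in> {m+1..CARD('n)}"
  shows "hdot (v k) (polar_part m lam u w \<xi> *v x) = 0"
proof -
  have "polar_part m lam u w \<xi> *v x
      = (\<Sum>l=1..m. (\<Sum>b\<in>UNIV. 1 / (\<xi> - lam l) * cnj (w l $ b) * x $ b) *s u l)"
    by (simp add: polar_part_def matrix_vector_mult_def vec_eq_iff sum_distrib_right sum_distrib_left)
       (subst sum.swap, simp add: mult_ac)
  then show ?thesis using assms by (simp add: out_orthogonal)
qed

lemma hdot_out_H_regular:
  assumes "k \<in> {m+1..CARD('n)}" "\<xi> \<in> regular_set"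
  shows "hdot (v k) (matrix_inv (T \<xi>) *v x) = hdot (v k) (H \<xi> *v x)"
  using assms by (simp add: matrix_inv_regular matrix_vector_mult_add_rdistrib hdot_out_polar_part)

text \<open>Where \<open>T(\<rho>)\<close> is invertible, \<open>x = T(\<rho>)\<^sup>-\<^sup>1 T(\<rho>) x\<close> and the polar part of the inverse is
  annihilated.  The eigenvalues are isolated and both sides are continuous, so the identity extends
  to them.\<close>

lemma hdot_out_H_T:
  assumes k: "k \<in> {m+1..CARD('n)}" and "\<rho> \<in> D"
  shows "hdot (v k) (H \<rho> *v (T \<rho> *v x)) = hdot (v k) x"
proof -
  let ?h = "\<lambda>z. hdot (v k) (H z *v (T z *v x))"
  have "open (D - (lam ` {1..m} - {\<rho>}))" using open_D by (intro open_Diff finite_imp_closed) auto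
  then have "eventually (\<lambda>z. z \<in> D - (lam ` {1..m} - {\<rho>})) (nhds \<rho>)"
    using assms(2) by (intro eventually_nhds_in_open) auto
  then have "eventually (\<lambda>z. z \<in> D \<and> z \<notin> lam ` {1..m}) (at \<rho>)"
    unfolding eventually_at_filter by (rule eventually_mono) auto
  then have ev: "eventually (\<lambda>z. hdot (v k) x = ?h z) (at \<rho>)"
  proof (rule eventually_mono)
    fix z assume "z \<in> D \<and> z \<notin> lam ` {1..m}"
    then have "z \<in> regular_set" using D_regular by blast
    then have "?h z = hdot (v k) (matrix_inv (T z) *v (T z *v x))"
      using hdot_out_H_regular[OF k] by simp
    also have "\<dots> = hdot (v k) x" using \<open>z \<in> regular_set\<close>
      by (simp add: matrix_vector_mul_assoc matrix_inv_inverse regular_set_def)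
    finally show "hdot (v k) x = ?h z" by simp
  qed
  have "\<rho> \<in> \<Omega>" using assms(2) D_subset by auto
  then have 1: "(?h \<longlongrightarrow> ?h \<rho>) (at \<rho>)"
    using assms(2) by (intro tendsto_intros T_tendsto H_tendsto)
  have "((\<lambda>z. hdot (v k) x) \<longlongrightarrow> ?h \<rho>) (at \<rho>)"
    using tendsto_cong[OF ev] 1 by blast
  then show ?thesis using tendsto_unique[OF _ _ tendsto_const] by (metis trivial_limit_at)
qed

text \<open>At the node itself, \<open>I - T(\<xi>)\<^sup>-\<^sup>1 T(\<rho>) = - T(\<xi>)\<^sup>-\<^sup>1 (T(\<rho>) - T(\<xi>))\<close> turns the quotient into the
  difference quotient of \<open>T\<close>, whose limit \<open>\<omega> T(\<xi>)\<^sup>-\<^sup>1 T'(\<xi>)\<close> is therefore the value of the term.\<close>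

lemma nl_term_tendsto:
  assumes "\<xi> \<in> regular_set" "\<rho> \<in> \<Omega>"
  shows "(nl_term T \<xi> \<omega> \<longlongrightarrow> nl_term T \<xi> \<omega> \<rho>) (at \<rho>)"
proof (cases "\<rho> = \<xi>")
  case False
  have "(nl_quotient T \<xi> \<omega> \<longlongrightarrow> nl_quotient T \<xi> \<omega> \<rho>) (at \<rho>)"
    unfolding nl_quotient_def using False assms by (intro tendsto_intros T_tendsto) auto
  moreover have "eventually (\<lambda>z. nl_term T \<xi> \<omega> z = nl_quotient T \<xi> \<omega> z) (at \<rho>)"
  proof -
    have "eventually (\<lambda>z. z \<in> - {\<xi>}) (nhds \<rho>)"
      using False by (intro eventually_nhds_in_open) auto
    then show ?thesis
      unfolding eventually_at_filter by (rule eventually_mono) (auto simp: nl_term_def)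
  qed
  ultimately show ?thesis using False by (simp add: nl_term_def tendsto_cong)
next
  case True
  have ev: "eventually (\<lambda>z. nl_term T \<xi> \<omega> z = nl_quotient T \<xi> \<omega> z) (at \<xi>)"
    by (simp add: eventually_at_filter nl_term_def)
  let ?l = "\<omega> *m (matrix_inv (T \<xi>) ** mat_deriv T \<xi>)"
  have eq: "nl_quotient T \<xi> \<omega> z = \<omega> *m (matrix_inv (T \<xi>) ** ((1 / (z - \<xi>)) *m (T z - T \<xi>)))"
    if "z \<noteq> \<xi>" for z
  proof -
    have 1: "mat 1 - matrix_inv (T \<xi>) ** T z = - (matrix_inv (T \<xi>) ** (T z - T \<xi>))"
      using assms(1) matrix_inv_inverse(2)[of "T \<xi>"]
      by (simp add: matrix_diff_ldistrib regular_set_def)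
    have "\<omega> / (\<xi> - z) = - (\<omega> / (z - \<xi>))" using that by (simp add: field_simps)
    then show ?thesis
      unfolding nl_quotient_def 1
      by (simp add: vec_eq_iff mat_scale_def matrix_matrix_mult_def sum_distrib_left mult_ac
          sum_negf[symmetric])
  qed
  have "((\<lambda>z. \<omega> *m (matrix_inv (T \<xi>) ** ((1 / (z - \<xi>)) *m (T z - T \<xi>)))) \<longlongrightarrow> ?l) (at \<xi>)"
    using mat_difference_quotient_tendsto[OF holo domain(1)] assms True
    by (intro tendsto_mat_scale tendsto_matrix_mult tendsto_const) auto
  moreover have "eventually (\<lambda>z. nl_quotient T \<xi> \<omega> z
      = \<omega> *m (matrix_inv (T \<xi>) ** ((1 / (z - \<xi>)) *m (T z - T \<xi>)))) (at \<xi>)"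
    unfolding eventually_at_filter using eq by (intro always_eventually) auto
  ultimately have lim: "(nl_quotient T \<xi> \<omega> \<longlongrightarrow> ?l) (at \<xi>)"
    using tendsto_cong by fast
  then have "nl_term T \<xi> \<omega> \<xi> = ?l"
    unfolding nl_term_def by (simp add: tendsto_Lim[OF trivial_limit_at])
  then show ?thesis using lim tendsto_cong[OF ev] True by simp
qed

lemma F_nl_tendsto:
  assumes "\<And>j. j \<in> {1..N} \<Longrightarrow> \<xi> j \<in> regular_set" "\<rho> \<in> \<Omega>"
  shows "(F_nl T N \<xi> \<omega> \<longlongrightarrow> F_nl T N \<xi> \<omega> \<rho>) (at \<rho>)"
  unfolding F_nl_def using assms by (intro tendsto_sum nl_term_tendsto) auto

lemma hdot_out_F_nl:
  assumes k: "k \<in> {m+1..CARD('n)}" and nodes: "\<And>j. j \<in> {1..N} \<Longrightarrow> \<xi> j \<in> regular_set"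
    and \<rho>: "\<rho> \<notin> \<xi> ` {1..N}"
  shows "hdot (v k) (F_nl T N \<xi> \<omega> \<rho> *v x) =
    (\<Sum>j=1..N. \<omega> j / (\<xi> j - \<rho>)) * hdot (v k) x - hdot (v k) (H_quad H N \<xi> \<omega> \<rho> *v (T \<rho> *v x))"
proof -
  have "hdot (v k) (F_nl T N \<xi> \<omega> \<rho> *v x)
      = (\<Sum>j=1..N. hdot (v k) (nl_term T (\<xi> j) (\<omega> j) \<rho> *v x))"
    unfolding F_nl_def by (simp add: sum_matrix_mult_vec)
  also have "\<dots> = (\<Sum>j=1..N. \<omega> j / (\<xi> j - \<rho>) * (hdot (v k) x - hdot (v k) (H (\<xi> j) *v (T \<rho> *v x))))"
  proof (rule sum.cong[OF refl])
    fix j assume j: "j \<in> {1..N}"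
    with \<rho> have "\<rho> \<noteq> \<xi> j" by auto
    then show "hdot (v k) (nl_term T (\<xi> j) (\<omega> j) \<rho> *v x)
        = \<omega> j / (\<xi> j - \<rho>) * (hdot (v k) x - hdot (v k) (H (\<xi> j) *v (T \<rho> *v x)))"
      using hdot_out_H_regular[OF k nodes[OF j], of "T \<rho> *v x"]
      by (simp add: nl_term_def nl_quotient_def mat_scale_mult_vec matrix_vector_mult_diff_rdistrib
          matrix_vector_mul_assoc right_diff_distrib diff_divide_distrib)
  qed
  also have "\<dots> = (\<Sum>j=1..N. \<omega> j / (\<xi> j - \<rho>)) * hdot (v k) x
      - hdot (v k) (H_quad H N \<xi> \<omega> \<rho> *v (T \<rho> *v x))"
    by (simp add: H_quad_def sum_matrix_mult_vec mat_scale_mult_vec right_diff_distrib sum_subtractf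
        sum_distrib_right)
  finally show ?thesis .
qed

text \<open>The image under \<open>F_nl\<close> has \<open>v k\<close>-component
  \<open>(c - 1) v\<^sub>k\<^sup>H x - v\<^sub>k\<^sup>H (H_quad(\<rho>) - H(\<rho>)) T(\<rho>) x\<close>, where \<open>c\<close> is the quadrature
  value for the indicator function of \<open>D\<close>.  The accuracy of \<open>c\<close> follows from that of
  \<open>F_nl\<close> by testing the identity on \<open>x = v k\<close>, where \<open>F_ci\<close> has component \<open>0\<close>.\<close>

lemma out_estimate_off_nodes:
  assumes k: "k \<in> {m+1..CARD('n)}" and nodes: "\<And>j. j \<in> {1..N} \<Longrightarrow> \<xi> j \<in> regular_set"
    and acc: "quadrature_accuracy T g H D0 N \<xi> \<omega> \<gamma>"
    and M: "\<And>z x. z \<in> D0 \<Longrightarrow> norm (T z *v x) \<le> M * norm x"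
    and \<rho>: "\<rho> \<in> D0" "\<rho> \<notin> \<xi> ` {1..N}"
  shows "cmod (hdot (v k) (F_nl T N \<xi> \<omega> \<rho> *v x))
      \<le> \<gamma> * ((1 + M) * cmod (hdot (v k) x) + norm (T \<rho> *v x))"
proof -
  let ?F = "F_nl T N \<xi> \<omega> \<rho>"
  define c where "c = (\<Sum>j=1..N. \<omega> j / (\<xi> j - \<rho>))"
  define E where "E = H_quad H N \<xi> \<omega> \<rho> - H \<rho>"
  have "\<rho> \<in> D" using \<rho> D0 by auto
  have E: "spectral_norm E \<le> \<gamma>" and F: "spectral_norm (F_ci T g \<rho> - ?F) \<le> \<gamma>"
    using acc \<rho> by (auto simp: quadrature_accuracy_def E_def)
  have \<gamma>: "\<gamma> \<ge> 0" using E spectral_norm_nonneg[of E] by linarith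
  have E_le: "cmod (hdot (v k) (E *v (T \<rho> *v y))) \<le> \<gamma> * norm (T \<rho> *v y)" for y
  proof -
    have "cmod (hdot (v k) (E *v (T \<rho> *v y))) \<le> spectral_norm E * norm (T \<rho> *v y)"
      using hdot_out_le[OF k] norm_mult_vec_le_spectral_norm order_trans by blast
    also have "\<dots> \<le> \<gamma> * norm (T \<rho> *v y)" using E by (rule mult_right_mono) simp
    finally show ?thesis .
  qed
  have Fx: "hdot (v k) (?F *v y) = (c - 1) * hdot (v k) y - hdot (v k) (E *v (T \<rho> *v y))" for y
    using hdot_out_F_nl[where x=y, OF k nodes \<rho>(2)] hdot_out_H_T[OF k \<open>\<rho> \<in> D\<close>, of y]
    by (simp add: E_def c_def matrix_vector_mult_diff_rdistrib algebra_simps)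
  have "cmod (c - 1) \<le> \<gamma> * (1 + M)"
  proof -
    have vk: "norm (v k) = 1" "hdot (v k) (v k) = 1" using out_norm[OF k] out_orthonormal[OF k k] by auto
    have "hdot (v k) (F_ci T g \<rho> *v v k) = 0"
      using hdot_out_H_T[OF k \<open>\<rho> \<in> D\<close>, of "v k"]
      by (simp add: F_ci_eq[OF \<open>\<rho> \<in> D\<close>] matrix_vector_mult_diff_rdistrib matrix_vector_mul_assoc)
    then have "c - 1 = hdot (v k) (E *v (T \<rho> *v v k)) - hdot (v k) ((F_ci T g \<rho> - ?F) *v v k)"
      using Fx[of "v k"] vk by (simp add: matrix_vector_mult_diff_rdistrib)
    then have "cmod (c - 1) \<le> cmod (hdot (v k) (E *v (T \<rho> *v v k)))
        + cmod (hdot (v k) ((F_ci T g \<rho> - ?F) *v v k))"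
      by (simp add: norm_triangle_ineq4)
    also have "cmod (hdot (v k) ((F_ci T g \<rho> - ?F) *v v k)) \<le> \<gamma>"
      using hdot_out_le[OF k, of "(F_ci T g \<rho> - ?F) *v v k"] vk(1) F
        norm_mult_vec_le_spectral_norm[of "F_ci T g \<rho> - ?F" "v k"] by simp
    also have "cmod (hdot (v k) (E *v (T \<rho> *v v k))) \<le> \<gamma> * M"
      using E_le[of "v k"] mult_left_mono[OF M[OF \<rho>(1), of "v k"] \<gamma>] vk(1) by simp
    finally show ?thesis by (simp add: algebra_simps)
  qed
  then have "cmod ((c - 1) * hdot (v k) x) \<le> \<gamma> * (1 + M) * cmod (hdot (v k) x)"
    unfolding norm_mult by (rule mult_right_mono) simp
  then show ?thesis
    using E_le[of x] norm_triangle_ineq4[of "(c - 1) * hdot (v k) x" "hdot (v k) (E *v (T \<rho> *v x))"]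
    unfolding Fx[of x] by (simp add: algebra_simps)
qed

text \<open>Both sides depend continuously on \<open>\<rho>\<close>, and every point of the interior of \<open>D0\<close> is a limit of
  points of \<open>D0\<close> that are not nodes.\<close>

lemma out_estimate:
  assumes k: "k \<in> {m+1..CARD('n)}" and nodes: "\<And>j. j \<in> {1..N} \<Longrightarrow> \<xi> j \<in> regular_set"
    and acc: "quadrature_accuracy T g H D0 N \<xi> \<omega> \<gamma>"
    and M: "\<And>z x. z \<in> D0 \<Longrightarrow> norm (T z *v x) \<le> M * norm x"
    and \<rho>: "\<rho> \<in> interior D0"
  shows "cmod (hdot (v k) (F_nl T N \<xi> \<omega> \<rho> *v x))
      \<le> \<gamma> * ((1 + M) * cmod (hdot (v k) x) + norm (T \<rho> *v x))"
proof (rule tendsto_le[OF trivial_limit_at])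
  have "\<rho> \<in> \<Omega>" using \<rho> interior_subset D0(2) D_subset by blast
  have F: "(F_nl T N \<xi> \<omega> \<longlongrightarrow> F_nl T N \<xi> \<omega> \<rho>) (at \<rho>)"
    using nodes \<open>\<rho> \<in> \<Omega>\<close> by (rule F_nl_tendsto)
  show "((\<lambda>z. cmod (hdot (v k) (F_nl T N \<xi> \<omega> z *v x)))
      \<longlongrightarrow> cmod (hdot (v k) (F_nl T N \<xi> \<omega> \<rho> *v x))) (at \<rho>)"
    by (intro tendsto_intros F)
  show "((\<lambda>z. \<gamma> * ((1 + M) * cmod (hdot (v k) x) + norm (T z *v x)))
      \<longlongrightarrow> \<gamma> * ((1 + M) * cmod (hdot (v k) x) + norm (T \<rho> *v x))) (at \<rho>)"
    by (intro tendsto_intros T_tendsto \<open>\<rho> \<in> \<Omega>\<close>)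
  have "open (interior D0 - (\<xi> ` {1..N} - {\<rho>}))" by (intro open_Diff finite_imp_closed) auto
  then have "eventually (\<lambda>z. z \<in> interior D0 - (\<xi> ` {1..N} - {\<rho>})) (nhds \<rho>)"
    using \<rho> by (intro eventually_nhds_in_open) auto
  then have "eventually (\<lambda>z. z \<in> D0 \<and> z \<notin> \<xi> ` {1..N}) (at \<rho>)"
    unfolding eventually_at_filter by (rule eventually_mono) (use interior_subset in blast)
  then show "eventually (\<lambda>z. cmod (hdot (v k) (F_nl T N \<xi> \<omega> z *v x))
      \<le> \<gamma> * ((1 + M) * cmod (hdot (v k) x) + norm (T z *v x))) (at \<rho>)"
    by (rule eventually_mono) (use out_estimate_off_nodes[OF k nodes acc M] in blast)
qed

end

section \<open>Estimates for approximate eigenpairs\<close>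

lemma cmod_le_coeff_norm: "finite S \<Longrightarrow> k \<in> S \<Longrightarrow> cmod (y k) \<le> coeff_norm S y"
  unfolding coeff_norm_def by (rule member_le_L2_set)

lemma coeff_norm_le_bound:
  assumes "finite S" "\<And>k. k \<in> S \<Longrightarrow> cmod (y k) \<le> B"
  shows "coeff_norm S y \<le> real (card S) * B"
proof -
  have "coeff_norm S y \<le> (\<Sum>k\<in>S. cmod (y k))"
    unfolding coeff_norm_def by (rule L2_set_le_sum) simp
  also have "\<dots> \<le> real (card S) * B" using assms(2) by (rule sum_bounded_above)
  finally show ?thesis .
qed

lemma norm_sum_scalar_le:
  fixes b :: "nat \<Rightarrow> complex^'n"
  assumes "\<And>k. k \<in> S \<Longrightarrow> norm (b k) = 1" "\<And>k. k \<in> S \<Longrightarrow> cmod (c k) \<le> B"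
  shows "norm (\<Sum>k\<in>S. c k *s b k) \<le> real (card S) * B"
  using assms by (intro order_trans[OF norm_sum] sum_bounded_above) (simp add: norm_scalar_vec)

context keldysh_problem
begin

text \<open>Since \<open>T(\<lambda>\<^sub>i) u\<^sub>i = 0\<close>, the residual divided by \<open>\<rho> - \<lambda>\<^sub>i\<close> is a difference quotient of \<open>T\<close> applied to
  \<open>u\<^sub>i\<close>; it converges and is therefore bounded near \<open>\<lambda>\<^sub>i\<close>.\<close>

lemma eigenvector_residual:
  assumes "i \<in> {1..m}"
  obtains L r where "L \<ge> 0" "r > 0"
    "\<And>\<rho>. cmod (\<rho> - lam i) < r \<Longrightarrow> norm (T \<rho> *v u i) \<le> L * cmod (\<rho> - lam i)"
proof -
  let ?z = "lam i"
  have z: "?z \<in> \<Omega>" and Tu: "T ?z *v u i = 0"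
    using eigenvalue_in_D[OF assms] D_subset eigenvectors(1)[OF assms] by (auto simp: eigenpair_def)
  define L where "L = norm (mat_deriv T ?z *v u i) + 1"
  have "((\<lambda>\<rho>. norm (((1 / (\<rho> - ?z)) *m (T \<rho> - T ?z)) *v u i)) \<longlongrightarrow> norm (mat_deriv T ?z *v u i)) (at ?z)"
    using mat_difference_quotient_tendsto[OF holo domain(1) z]
    by (intro tendsto_norm tendsto_matrix_vector_mult tendsto_const)
  then have "eventually (\<lambda>\<rho>. norm (((1 / (\<rho> - ?z)) *m (T \<rho> - T ?z)) *v u i) < L) (at ?z)"
    by (rule order_tendstoD) (simp add: L_def)
  then obtain r where r: "r > 0" "\<And>\<rho>. \<rho> \<noteq> ?z \<Longrightarrow> dist \<rho> ?z < r \<Longrightarrow>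
      norm (((1 / (\<rho> - ?z)) *m (T \<rho> - T ?z)) *v u i) < L"
    unfolding eventually_at by auto
  show thesis
  proof (rule that[of L r])
    fix \<rho> assume \<rho>: "cmod (\<rho> - ?z) < r"
    show "norm (T \<rho> *v u i) \<le> L * cmod (\<rho> - ?z)"
    proof (cases "\<rho> = ?z")
      case False
      have "norm (T \<rho> *v u i) / cmod (\<rho> - ?z) = norm (((1 / (\<rho> - ?z)) *m (T \<rho> - T ?z)) *v u i)"
        by (simp add: mat_scale_mult_vec norm_scalar_vec matrix_vector_mult_diff_rdistrib Tu norm_divide)
      also have "\<dots> < L" using r(2)[of \<rho>] False \<rho> by (simp add: dist_norm)
      finally show ?thesis using False by (simp add: pos_divide_less_eq)
    qed (simp add: Tu)
  qed (use r(1) in \<open>simp_all add: L_def\<close>)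
qed

text \<open>The coefficients \<open>z'\<close> are the components \<open>v\<^sub>k\<^sup>H x'\<close> and are bounded by \<open>out_estimate\<close>.  For the others,
  \<open>x' - x\<close> is \<open>O(\<gamma> + \<epsilon>)\<close>; after subtraction of its components along the \<open>v\<^sub>k\<close>, which are no larger, it is
  a combination of the \<open>u\<^sub>k\<close> with coefficients \<open>\<alpha>' - 1\<close> and \<open>y' k - y k\<close>.  The constants \<open>K\<close> and \<open>\<delta>\<close>
  precede the quadrature rule and the approximate eigenpair, hence depend on neither.\<close>

lemma approximate_eigenpair_estimate:
  assumes i: "i \<in> {1..m}"
  shows "\<exists>K>0. \<exists>\<delta>>0. \<forall>N \<xi> \<omega> \<rho> x y z x' \<alpha>' y' z' \<gamma> \<epsilon>.
    (\<forall>j\<in>{1..N}. \<xi> j \<in> \<Omega> \<and> invertible (T (\<xi> j))) \<longrightarrow>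
    quadrature_accuracy T g H D0 N \<xi> \<omega> \<gamma> \<longrightarrow>
    x = combination m u v i 1 y z \<longrightarrow>
    x' = F_nl T N \<xi> \<omega> \<rho> *v x \<longrightarrow>
    x' = combination m u v i \<alpha>' y' z' \<longrightarrow>
    cmod (\<rho> - lam i) \<le> \<epsilon> \<longrightarrow>
    coeff_norm ({1..m} - {i}) y \<le> \<epsilon> \<longrightarrow>
    coeff_norm {m+1..CARD('n)} z \<le> \<epsilon> \<longrightarrow>
    \<epsilon> \<le> \<delta> \<longrightarrow>
    cmod (\<alpha>' - 1) \<le> K * (\<gamma> + \<epsilon>) \<and>
    coeff_norm ({1..m} - {i}) y' \<le> K * (\<gamma> + \<epsilon>) \<and>
    coeff_norm {m+1..CARD('n)} z' \<le> K * (\<gamma> * \<epsilon>)"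
proof -
  let ?out = "{m+1..CARD('n)}"
  define n where "n = real (card ?out)"
  have n: "n \<ge> 0" by (simp add: n_def)
  obtain L r where L: "L \<ge> 0" "r > 0"
    "\<And>\<rho>. cmod (\<rho> - lam i) < r \<Longrightarrow> norm (T \<rho> *v u i) \<le> L * cmod (\<rho> - lam i)"
    using eigenvector_residual[OF i] by metis
  obtain s where s: "s > 0" "ball (lam i) s \<subseteq> interior D0"
    using D0(3)[OF i] open_contains_ball[of "interior D0"] by auto
  have "D0 \<subseteq> \<Omega>" using D0(2) D_subset by auto
  then obtain M where M: "M \<ge> 0" "\<And>z x. z \<in> D0 \<Longrightarrow> norm (T z *v x) \<le> M * norm x"
    using holomorphic_matrix_bounded[OF holo D0(1)] by metis
  have "D0 \<subseteq> D \<union> regular_set" using D0(2) by auto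
  then obtain MH where MH: "MH \<ge> 0" "\<And>z x. z \<in> D0 \<Longrightarrow> norm (H z *v x) \<le> MH * norm x"
    using holomorphic_matrix_bounded[OF H_holomorphic D0(1)] by metis
  obtain C where C: "C > 0"
    "\<And>c k. k \<in> {1..m} \<Longrightarrow> cmod (c k) \<le> C * norm (\<Sum>j\<in>{1..m}. c j *s u j)"
    using independent_coefficient_bound[OF independent finite_atLeastAtMost eigenvectors(2)] by metis
  \<comment> \<open>\<open>C0\<close> bounds \<open>norm (x - u\<^sub>i) / \<epsilon>\<close>, \<open>A\<close> bounds \<open>norm (T \<rho> x) / \<epsilon>\<close>, \<open>B\<close> bounds
    \<open>norm (x' - x) / (\<gamma> + \<epsilon>)\<close>, and \<open>E\<close> bounds the coefficients of \<open>x' - x\<close> along the eigenvectors, likewise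
    divided by \<open>\<gamma> + \<epsilon>\<close>\<close>
  define C0 where "C0 = real m + n"
  define A where "A = L + M * C0"
  define B where "B = 1 + C0 + MH * A"
  define E where "E = C * ((1 + n) * B)"
  define K where "K = E + real m * (E + 1) + n * (1 + M + A) + 1"
  have C0: "C0 \<ge> 0" using n by (simp add: C0_def)
  have A: "A \<ge> 0" using L(1) M(1) C0 by (simp add: A_def)
  have B: "B \<ge> 0" using C0 MH(1) A by (simp add: B_def)
  have E: "E \<ge> 0" using C(1) n B by (simp add: E_def)
  have K: "K > 0" "E \<le> K" "real m * (E + 1) \<le> K" "n * (1 + M + A) \<le> K"
    using E n M(1) A mult_nonneg_nonneg[of "real m" "E + 1"] mult_nonneg_nonneg[of n "1 + M + A"]
    unfolding K_def by linarith+
  \<comment> \<open>the cap \<open>1\<close> keeps \<open>norm x\<close> bounded\<close>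
  define \<delta> where "\<delta> = min (min (r / 2) (s / 2)) 1"
  have \<delta>: "\<delta> > 0" "\<delta> < r" "\<delta> < s" "\<delta> \<le> 1" using L(2) s(1) by (auto simp: \<delta>_def)

  have main: "cmod (\<alpha>' - 1) \<le> K * (\<gamma> + \<epsilon>) \<and>
    coeff_norm ({1..m} - {i}) y' \<le> K * (\<gamma> + \<epsilon>) \<and>
    coeff_norm ?out z' \<le> K * (\<gamma> * \<epsilon>)"
    if nodes: "\<forall>j\<in>{1..N}. \<xi> j \<in> \<Omega> \<and> invertible (T (\<xi> j))"
      and acc: "quadrature_accuracy T g H D0 N \<xi> \<omega> \<gamma>"
      and x: "x = combination m u v i 1 y z"
      and x': "x' = F_nl T N \<xi> \<omega> \<rho> *v x" "x' = combination m u v i \<alpha>' y' z'"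
      and \<rho>: "cmod (\<rho> - lam i) \<le> \<epsilon>"
      and y: "coeff_norm ({1..m} - {i}) y \<le> \<epsilon>"
      and z: "coeff_norm ?out z \<le> \<epsilon>" and "\<epsilon> \<le> \<delta>"
    for N \<xi> \<omega> \<rho> x y z x' \<alpha>' y' z' \<gamma> \<epsilon>
  proof -
    have \<epsilon>: "0 \<le> \<epsilon>" "\<epsilon> \<le> 1" "\<epsilon> < r" "\<epsilon> < s"
      using \<rho> \<delta> \<open>\<epsilon> \<le> \<delta>\<close> norm_ge_zero[of "\<rho> - lam i"] by linarith+
    have reg: "\<xi> j \<in> regular_set" if "j \<in> {1..N}" for j
      using nodes that by (simp add: regular_set_def)
    have "\<rho> \<in> ball (lam i) s" using \<rho> \<epsilon> by (simp add: dist_norm norm_minus_commute)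
    then have \<rho>_int: "\<rho> \<in> interior D0" using s(2) by auto
    then have \<rho>0: "\<rho> \<in> D0" and \<rho>D: "\<rho> \<in> D" using interior_subset D0(2) by auto
    have acc\<rho>: "spectral_norm (F_ci T g \<rho> - F_nl T N \<xi> \<omega> \<rho>) \<le> \<gamma>"
      using acc \<rho>0 by (simp add: quadrature_accuracy_def)
    have \<gamma>: "\<gamma> \<ge> 0" using acc\<rho> spectral_norm_nonneg order_trans by blast
    have yk: "cmod (y k) \<le> \<epsilon>" if "k \<in> {1..m} - {i}" for k
      using cmod_le_coeff_norm[OF _ that, of y] y by simp
    have zk: "cmod (z k) \<le> \<epsilon>" if "k \<in> ?out" for k
      using cmod_le_coeff_norm[OF _ that, of z] z by simp

    have x_u: "norm (x - u i) \<le> C0 * \<epsilon>"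
    proof -
      have "x - u i = (\<Sum>k\<in>{1..m} - {i}. y k *s u k) + (\<Sum>k\<in>?out. z k *s v k)"
        by (simp add: x combination_def)
      then have "norm (x - u i) \<le> norm (\<Sum>k\<in>{1..m} - {i}. y k *s u k) + norm (\<Sum>k\<in>?out. z k *s v k)"
        by (simp add: norm_triangle_ineq)
      also have "\<dots> \<le> real (card ({1..m} - {i})) * \<epsilon> + n * \<epsilon>"
        unfolding n_def
        by (intro add_mono norm_sum_scalar_le yk zk) (simp_all add: eigenvectors(2) out_norm)
      also have "\<dots> \<le> C0 * \<epsilon>"
        unfolding C0_def distrib_right using \<epsilon>(1) card_Diff1_le[of "{1..m}" i]
        by (intro add_mono mult_right_mono) auto
      finally show ?thesis .
    qed
    have norm_x: "norm x \<le> 1 + C0"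
      using norm_triangle_ineq[of "u i" "x - u i"] eigenvectors(2)[OF i] x_u
        mult_left_mono[OF \<epsilon>(2) C0] by simp
    have Tx: "norm (T \<rho> *v x) \<le> A * \<epsilon>"
    proof -
      have "T \<rho> *v x = T \<rho> *v u i + T \<rho> *v (x - u i)"
        by (simp add: matrix_vector_mult_diff_distrib)
      then have "norm (T \<rho> *v x) \<le> norm (T \<rho> *v u i) + norm (T \<rho> *v (x - u i))"
        by (simp add: norm_triangle_ineq)
      also have "\<dots> \<le> L * cmod (\<rho> - lam i) + M * norm (x - u i)"
        using L(3)[of \<rho>] \<rho> \<epsilon> M(2)[OF \<rho>0] by (intro add_mono) auto
      also have "\<dots> \<le> L * \<epsilon> + M * (C0 * \<epsilon>)"
        using L(1) M(1) \<rho> x_u by (intro add_mono mult_left_mono)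
      finally show ?thesis by (simp add: A_def algebra_simps)
    qed
    have x'_x: "norm (x' - x) \<le> B * (\<gamma> + \<epsilon>)"
    proof -
      have "x' - x = - ((F_ci T g \<rho> - F_nl T N \<xi> \<omega> \<rho>) *v x) - H \<rho> *v (T \<rho> *v x)"
        by (simp add: x'(1) F_ci_eq[OF \<rho>D] matrix_vector_mult_diff_rdistrib matrix_vector_mul_assoc)
      then have "norm (x' - x) \<le> norm ((F_ci T g \<rho> - F_nl T N \<xi> \<omega> \<rho>) *v x) + norm (H \<rho> *v (T \<rho> *v x))"
        using norm_triangle_ineq4[of "- ((F_ci T g \<rho> - F_nl T N \<xi> \<omega> \<rho>) *v x)"] by simp
      also have "\<dots> \<le> \<gamma> * (1 + C0) + MH * (A * \<epsilon>)"
      proof (rule add_mono)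
        show "norm ((F_ci T g \<rho> - F_nl T N \<xi> \<omega> \<rho>) *v x) \<le> \<gamma> * (1 + C0)"
          using norm_mult_vec_le_spectral_norm[of "F_ci T g \<rho> - F_nl T N \<xi> \<omega> \<rho>" x]
            mult_mono[OF acc\<rho> norm_x \<gamma>] by simp
        show "norm (H \<rho> *v (T \<rho> *v x)) \<le> MH * (A * \<epsilon>)"
          using MH(2)[OF \<rho>0, of "T \<rho> *v x"] mult_left_mono[OF Tx MH(1)] by simp
      qed
      also have "\<dots> \<le> B * \<gamma> + B * \<epsilon>"
        using \<gamma> \<epsilon>(1) C0 MH(1) A mult_right_mono[of "1 + C0" B \<gamma>] mult_right_mono[of "MH * A" B \<epsilon>]
        by (simp add: B_def mult.commute[of \<gamma>] mult.assoc)
      finally show ?thesis by (simp add: distrib_left)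
    qed

    have z': "cmod (z' k) \<le> (1 + M + A) * (\<gamma> * \<epsilon>)" if k: "k \<in> ?out" for k
    proof -
      have "z' k = hdot (v k) (F_nl T N \<xi> \<omega> \<rho> *v x)" "z k = hdot (v k) x"
        using hdot_out_combination[OF k i] x x' by metis+
      then have "cmod (z' k) \<le> \<gamma> * ((1 + M) * cmod (z k) + norm (T \<rho> *v x))"
        using out_estimate[where x=x, OF k reg acc M(2) \<rho>_int] by simp
      also have "\<dots> \<le> \<gamma> * ((1 + M) * \<epsilon> + A * \<epsilon>)"
        using \<gamma> M(1) zk[OF k] Tx by (intro mult_left_mono add_mono) auto
      finally show ?thesis by (simp add: algebra_simps)
    qed

    define c where "c = (\<lambda>k. if k = i then \<alpha>' - 1 else y' k - y k)"
    have c: "cmod (c k) \<le> E * (\<gamma> + \<epsilon>)" if k: "k \<in> {1..m}" for k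
    proof -
      let ?V = "\<Sum>l\<in>?out. (z' l - z l) *s v l"
      have "(\<Sum>l\<in>{1..m}. c l *s u l) = c i *s u i + (\<Sum>l\<in>{1..m} - {i}. c l *s u l)"
        using i by (intro sum.remove) auto
      also have "(\<Sum>l\<in>{1..m} - {i}. c l *s u l) = (\<Sum>l\<in>{1..m} - {i}. y' l *s u l - y l *s u l)"
        by (intro sum.cong) (auto simp: c_def)
      also have "c i *s u i + \<dots> = (x' - x) - ?V"
        unfolding x x'(2) combination_def
        by (simp add: c_def sum_subtractf algebra_simps)
      finally have "norm (\<Sum>l\<in>{1..m}. c l *s u l) \<le> norm (x' - x) + norm ?V"
        by (simp add: norm_triangle_ineq4)
      also have "norm ?V \<le> n * norm (x' - x)"
        unfolding n_def
      proof (rule norm_sum_scalar_le)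
        fix l assume l: "l \<in> ?out"
        show "norm (v l) = 1" using l by (rule out_norm)
        have eq: "z' l - z l = hdot (v l) (x' - x)"
          using hdot_out_combination[OF l i] x x'(2) by simp
        show "cmod (z' l - z l) \<le> norm (x' - x)" unfolding eq by (rule hdot_out_le[OF l])
      qed
      finally have "norm (\<Sum>l\<in>{1..m}. c l *s u l) \<le> (1 + n) * norm (x' - x)"
        by (simp add: algebra_simps)
      also have "\<dots> \<le> (1 + n) * (B * (\<gamma> + \<epsilon>))" using n x'_x by (intro mult_left_mono) auto
      finally have "C * norm (\<Sum>l\<in>{1..m}. c l *s u l) \<le> C * ((1 + n) * (B * (\<gamma> + \<epsilon>)))"
        using C(1) by (intro mult_left_mono) auto
      then show ?thesis using C(2)[OF k, of c] by (simp add: E_def mult.assoc)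
    qed
    have y': "cmod (y' k) \<le> (E + 1) * (\<gamma> + \<epsilon>)" if k: "k \<in> {1..m} - {i}" for k
    proof -
      have "y' k = c k + y k" using k by (simp add: c_def)
      then have "cmod (y' k) \<le> cmod (c k) + cmod (y k)" by (simp add: norm_triangle_ineq)
      also have "\<dots> \<le> E * (\<gamma> + \<epsilon>) + (\<gamma> + \<epsilon>)" using c[of k] yk[OF k] k \<gamma> by (intro add_mono) auto
      finally show ?thesis by (simp add: algebra_simps)
    qed
    show ?thesis
    proof (intro conjI)
      have "cmod (\<alpha>' - 1) \<le> E * (\<gamma> + \<epsilon>)" using c[OF i] by (simp add: c_def)
      also have "\<dots> \<le> K * (\<gamma> + \<epsilon>)" using K \<gamma> \<epsilon> by (intro mult_right_mono) auto
      finally show "cmod (\<alpha>' - 1) \<le> K * (\<gamma> + \<epsilon>)" .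
      have "coeff_norm ({1..m} - {i}) y' \<le> real (card ({1..m} - {i})) * ((E + 1) * (\<gamma> + \<epsilon>))"
        using y' by (intro coeff_norm_le_bound) auto
      also have "\<dots> \<le> real m * ((E + 1) * (\<gamma> + \<epsilon>))"
        using card_Diff1_le[of "{1..m}" i] E \<gamma> \<epsilon> by (intro mult_right_mono) auto
      also have "\<dots> \<le> K * (\<gamma> + \<epsilon>)"
        unfolding mult.assoc[symmetric] using K \<gamma> \<epsilon> by (intro mult_right_mono) auto
      finally show "coeff_norm ({1..m} - {i}) y' \<le> K * (\<gamma> + \<epsilon>)" .
      have "coeff_norm ?out z' \<le> n * ((1 + M + A) * (\<gamma> * \<epsilon>))"
        unfolding n_def using z' by (intro coeff_norm_le_bound) auto
      also have "\<dots> \<le> K * (\<gamma> * \<epsilon>)"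
        unfolding mult.assoc[symmetric, of n] using K \<gamma> \<epsilon> by (intro mult_right_mono) auto
      finally show "coeff_norm ?out z' \<le> K * (\<gamma> * \<epsilon>)" .
    qed
  qed
  show ?thesis
    by (rule exI[of _ K], rule conjI[OF K(1)], rule exI[of _ \<delta>], rule conjI[OF \<delta>(1)],
        intro allI impI, rule main; assumption)
qed

end

theorem theorem7:
  fixes T H :: "complex \<Rightarrow> complex^'n^'n"
    and \<Omega> D D0 :: "complex set"
    and g :: "real \<Rightarrow> complex"
    and m :: nat
    and lam :: "nat \<Rightarrow> complex"
    and u v w :: "nat \<Rightarrow> complex^'n"
  assumes jordan: "simple_path g" "pathfinish g = pathstart g" "rectifiable_path g"
    and D: "D = inside (path_image g)"
    and oriented: "\<forall>z\<in>D. winding_number g z = 1"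
    and domain: "open \<Omega>" "connected \<Omega>" "closure D \<subseteq> \<Omega>"
    and holo: "mat_holomorphic_on T \<Omega>"
    and regular: "\<exists>\<xi>0\<in>D. det (T \<xi>0) \<noteq> 0"
    and boundary: "\<forall>\<xi>\<in>path_image g. invertible (T \<xi>)"
    and eigenvalues: "inj_on lam {1..m}" "lam ` {1..m} = {z \<in> D. \<exists>x. eigenpair T z x}"
    and simple: "\<forall>i\<in>{1..m}. simple_eigenvalue T (lam i)"
    and eigenvectors: "\<forall>i\<in>{1..m}. eigenpair T (lam i) (u i) \<and> norm (u i) = 1"
    and independent: "inj_on u {1..m}" "vec.independent (u ` {1..m})"
    and decomposition: "keldysh T \<Omega> D m lam u w H"
    and out: "orthonormal_basis_of_complement m u v"
    and D0: "compact D0" "D0 \<subseteq> D" "\<forall>i\<in>{1..m}. lam i \<in> interior D0"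
  shows "\<exists>K>0. \<exists>\<delta>>0. \<forall>cT>0. \<forall>CT>0.
    \<forall>(N::nat) (\<xi>::nat \<Rightarrow> complex) (\<omega>::nat \<Rightarrow> complex)
     (\<rho>::nat \<Rightarrow> complex) (x::nat \<Rightarrow> complex^'n) (y::nat \<Rightarrow> nat \<Rightarrow> complex) (z::nat \<Rightarrow> nat \<Rightarrow> complex)
     (x'::nat \<Rightarrow> complex^'n) (\<alpha>'::nat \<Rightarrow> complex) (y'::nat \<Rightarrow> nat \<Rightarrow> complex) (z'::nat \<Rightarrow> nat \<Rightarrow> complex)
     (\<gamma>::real) (\<epsilon>::real).
       (\<forall>j\<in>{1..N}. \<xi> j \<in> \<Omega> \<and> invertible (T (\<xi> j))) \<longrightarrow>
       \<gamma> = CT * exp (- cT * real N) \<longrightarrow>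
       quadrature_accuracy T g H D0 N \<xi> \<omega> \<gamma> \<longrightarrow>
       (\<forall>i\<in>{1..m}. x i = combination m u v i 1 (y i) (z i)) \<longrightarrow>
       (\<forall>i\<in>{1..m}. x' i = F_nl T N \<xi> \<omega> (\<rho> i) *v x i) \<longrightarrow>
       (\<forall>i\<in>{1..m}. x' i = combination m u v i (\<alpha>' i) (y' i) (z' i)) \<longrightarrow>
       \<epsilon> = Max ((\<lambda>i. Max {cmod (\<rho> i - lam i), coeff_norm ({1..m} - {i}) (y i),
                          coeff_norm {m+1..CARD('n)} (z i)}) ` {1..m}) \<longrightarrow>
       \<epsilon> \<le> \<delta> \<longrightarrow>
       (\<forall>i\<in>{1..m}. cmod (\<alpha>' i - 1) \<le> K * (\<gamma> + \<epsilon>) \<and>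
                    coeff_norm ({1..m} - {i}) (y' i) \<le> K * (\<gamma> + \<epsilon>) \<and>
                    coeff_norm {m+1..CARD('n)} (z' i) \<le> K * (\<gamma> * \<epsilon>))"
proof -
  interpret keldysh_problem T H \<Omega> D D0 g m lam u v w
    by unfold_locales (use assms in blast)+
  let ?out = "{m+1..CARD('n)}"
  define P where "P = (\<lambda>i K \<delta>. \<forall>N \<xi> \<omega> \<rho> x y z x' \<alpha>' y' z' \<gamma> \<epsilon>.
    (\<forall>j\<in>{1..N}. \<xi> j \<in> \<Omega> \<and> invertible (T (\<xi> j))) \<longrightarrow>
    quadrature_accuracy T g H D0 N \<xi> \<omega> \<gamma> \<longrightarrow>
    x = combination m u v i 1 y z \<longrightarrow>
    x' = F_nl T N \<xi> \<omega> \<rho> *v x \<longrightarrow>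
    x' = combination m u v i \<alpha>' y' z' \<longrightarrow>
    cmod (\<rho> - lam i) \<le> \<epsilon> \<longrightarrow>
    coeff_norm ({1..m} - {i}) y \<le> \<epsilon> \<longrightarrow>
    coeff_norm ?out z \<le> \<epsilon> \<longrightarrow>
    \<epsilon> \<le> \<delta> \<longrightarrow>
    cmod (\<alpha>' - 1) \<le> K * (\<gamma> + \<epsilon>) \<and>
    coeff_norm ({1..m} - {i}) y' \<le> K * (\<gamma> + \<epsilon>) \<and>
    coeff_norm ?out z' \<le> K * (\<gamma> * \<epsilon>))"
  have "\<forall>i\<in>{1..m}. \<exists>K>0. \<exists>\<delta>>0. P i K \<delta>"
    unfolding P_def using approximate_eigenpair_estimate by blast
  then obtain Kf \<delta>f where P: "\<And>i. i \<in> {1..m} \<Longrightarrow> Kf i > 0 \<and> \<delta>f i > 0 \<and> P i (Kf i) (\<delta>f i)"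
    by metis
  define K where "K = (\<Sum>i=1..m. Kf i) + 1"
  define \<delta> where "\<delta> = Min (insert 1 (\<delta>f ` {1..m}))"
  have "K > 0" unfolding K_def using P by (intro add_nonneg_pos sum_nonneg) (auto simp: less_imp_le)
  have "\<delta> > 0" unfolding \<delta>_def using P by (subst Min_gr_iff) auto
  have Kf: "Kf i \<le> K" if "i \<in> {1..m}" for i
  proof -
    have "Kf i \<le> (\<Sum>i=1..m. Kf i)" by (rule member_le_sum) (use that P less_imp_le in auto)
    then show ?thesis by (simp add: K_def)
  qed
  have \<delta>f: "\<delta> \<le> \<delta>f i" if "i \<in> {1..m}" for i
    unfolding \<delta>_def using that by (intro Min_le) auto
  show ?thesis
  proof (rule exI[of _ K], rule conjI[OF \<open>K > 0\<close>], rule exI[of _ \<delta>], rule conjI[OF \<open>\<delta> > 0\<close>],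
      intro allI impI ballI)
    fix cT CT :: real and N :: nat and \<xi> \<omega> \<rho> :: "nat \<Rightarrow> complex" and x :: "nat \<Rightarrow> complex^'n"
      and y z :: "nat \<Rightarrow> nat \<Rightarrow> complex" and x' :: "nat \<Rightarrow> complex^'n" and \<alpha>' :: "nat \<Rightarrow> complex"
      and y' z' :: "nat \<Rightarrow> nat \<Rightarrow> complex" and \<gamma> \<epsilon> :: real and i :: nat
    assume "0 < cT" "0 < CT"
      and nodes: "\<forall>j\<in>{1..N}. \<xi> j \<in> \<Omega> \<and> invertible (T (\<xi> j))"
      and \<gamma>: "\<gamma> = CT * exp (- cT * real N)"
      and acc: "quadrature_accuracy T g H D0 N \<xi> \<omega> \<gamma>"
      and x: "\<forall>i\<in>{1..m}. x i = combination m u v i 1 (y i) (z i)"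
      and F: "\<forall>i\<in>{1..m}. x' i = F_nl T N \<xi> \<omega> (\<rho> i) *v x i"
      and x': "\<forall>i\<in>{1..m}. x' i = combination m u v i (\<alpha>' i) (y' i) (z' i)"
      and \<epsilon>: "\<epsilon> = Max ((\<lambda>i. Max {cmod (\<rho> i - lam i), coeff_norm ({1..m} - {i}) (y i),
                          coeff_norm ?out (z i)}) ` {1..m})"
      and "\<epsilon> \<le> \<delta>" and i: "i \<in> {1..m}"
    have "Max {cmod (\<rho> i - lam i), coeff_norm ({1..m} - {i}) (y i), coeff_norm ?out (z i)} \<le> \<epsilon>"
      unfolding \<epsilon> using i by (intro Max_ge) auto
    then have le: "cmod (\<rho> i - lam i) \<le> \<epsilon>" "coeff_norm ({1..m} - {i}) (y i) \<le> \<epsilon>"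
      "coeff_norm ?out (z i) \<le> \<epsilon>"
      by simp_all
    have "\<epsilon> \<ge> 0" using le(1) norm_ge_zero order_trans by blast
    have "\<gamma> > 0" using \<open>0 < CT\<close> by (simp add: \<gamma>)
    have "P i (Kf i) (\<delta>f i)" using P[OF i] by blast
    then have "cmod (\<alpha>' i - 1) \<le> Kf i * (\<gamma> + \<epsilon>) \<and>
        coeff_norm ({1..m} - {i}) (y' i) \<le> Kf i * (\<gamma> + \<epsilon>) \<and>
        coeff_norm ?out (z' i) \<le> Kf i * (\<gamma> * \<epsilon>)"
      using nodes acc bspec[OF x i] bspec[OF F i] bspec[OF x' i] le order_trans[OF \<open>\<epsilon> \<le> \<delta>\<close> \<delta>f[OF i]]
      unfolding P_def by blast
    moreover have "Kf i * (\<gamma> + \<epsilon>) \<le> K * (\<gamma> + \<epsilon>)" "Kf i * (\<gamma> * \<epsilon>) \<le> K * (\<gamma> * \<epsilon>)"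
      using Kf[OF i] \<open>\<gamma> > 0\<close> \<open>\<epsilon> \<ge> 0\<close> by (auto intro!: mult_right_mono)
    ultimately show "cmod (\<alpha>' i - 1) \<le> K * (\<gamma> + \<epsilon>) \<and>
        coeff_norm ({1..m} - {i}) (y' i) \<le> K * (\<gamma> + \<epsilon>) \<and>
        coeff_norm ?out (z' i) \<le> K * (\<gamma> * \<epsilon>)"
      by linarith
  qed
qed

end
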